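(* There exist constants $C>0$ and $\varepsilon>0$, depending only on $d,\lambda,\Lambda,\alpha,\varphi$, such that the following holds. Let $0<r\le1$, $C_0\ge0$, and let $u:\mathbb{R}^d\to\mathbb{R}$ satisfy $u\ge0$ in $\mathbb{R}^d$ and $\mathcal{M}^-u\le C_0$ in $B_{2r}$ in the viscosity sense. Then $$|\{u\ge t\}\cap B_r|\le C\,r^d\,(u(0)+C_0r^\alpha)^{\varepsilon}\,t^{-\varepsilon}\qquad\text{for every }t>0 .$$ In particular, $$\|u\|_{L^{\varepsilon/2}(B_r)}\le C\,(u(0)+C_0r^\alpha).$$
   Context: Setting. $d\ge1$ is the dimension, $0<\lambda\le\Lambda$ are constants, $\beta\in(0,2)$, $\alpha\in(\beta,2)$. The function $\varphi:(0,\infty)\to(0,\infty)$ is locally bounded and satisfies, for some constant $\kappa_\circ>0$, $\varphi(st)\le\kappa_\circ s^\beta\varphi(t)$ for all $s\ge1$, $t>0$, and $\int_0^1\frac{\varphi(y)}{y}\,dy<\infty$. Dependence of constants on $\varphi$ includes dependence on $\beta,\kappa_\circ$. Operator. $\delta(u,x,y)=u(x+y)+u(x-y)-2u(x)$, with positive and negative parts $\delta^\pm$ ($\delta=\delta^+-\delta^-$), and $$\mathcal{M}^-u(x)=\int_{\mathbb{R}^d}\Bigl[\frac{\lambda\,\delta^+(u,x,y)}{|y|^d}\,\frac{2-\alpha}{|y|^\alpha}-\frac{\Lambda\,\delta^-(u,x,y)}{|y|^d}\Bigl(\frac{2-\alpha}{|y|^\alpha}+\varphi(1/|y|)\Bigr)\Bigr]dy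 .$$ Viscosity sense. For an open set $\Omega$, a bounded function $u:\mathbb{R}^d\to\mathbb{R}$, lower semicontinuous in $\overline\Omega$, satisfies $Iu\le g$ in $\Omega$ in the viscosity sense (viscosity supersolution) if, whenever a $C^2$ function $\psi$ touches $u$ from below at $x\in\Omega$ in a small neighbourhood $N_x\Subset\Omega$ (i.e. $\psi\le u$ in $N_x$, $\psi(x)=u(x)$), the function $v$ equal to $\psi$ in $N_x$ and to $u$ elsewhere satisfies $Iv(x)\le g(x)$. $B_r$ is the ball of radius $r$ centred at $0$; $|\cdot|$ of a set is Lebesgue measure; $\|u\|_{L^{q}(B_r)}=(\int_{B_r}|u|^q)^{1/q}$ also for $0<q<1$. *)

theory Defs
  imports "HOL-Analysis.Analysis"
begin

text \<open>Kernel weights. Only the values on the positive half-line matter. Set-integrability on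
  \<open>]0,1[\<close> is the condition \<open>\<integral>\<^sub>0\<^sup>1 \<phi>(y)/y dy < \<infinity>\<close>; measurability is implicit in the
  operator below being given by an integral.\<close>

definition admissible_weight :: "real \<Rightarrow> real \<Rightarrow> (real \<Rightarrow> real) \<Rightarrow> bool" where
  "admissible_weight \<beta> \<kappa> \<phi> \<longleftrightarrow>
     (\<forall>t>0. \<phi> t > 0) \<and>
     \<phi> \<in> borel_measurable (lebesgue_on {0<..}) \<and>
     (\<forall>K. compact K \<and> K \<subseteq> {0<..} \<longrightarrow> bounded (\<phi> ` K)) \<and>
     (\<forall>s\<ge>1. \<forall>t>0. \<phi> (s * t) \<le> \<kappa> * s powr \<beta> * \<phi> t) \<and>
     set_integrable lebesgue {0<..<1} (\<lambda>y. \<phi> y / y)"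

definition second_diff :: "('a::euclidean_space \<Rightarrow> real) \<Rightarrow> 'a \<Rightarrow> 'a \<Rightarrow> real" where
  "second_diff u x y = u (x + y) + u (x - y) - 2 * u x"

definition second_diff_pos :: "('a::euclidean_space \<Rightarrow> real) \<Rightarrow> 'a \<Rightarrow> 'a \<Rightarrow> real" where
  "second_diff_pos u x y = max (second_diff u x y) 0"

definition second_diff_neg :: "('a::euclidean_space \<Rightarrow> real) \<Rightarrow> 'a \<Rightarrow> 'a \<Rightarrow> real" where
  "second_diff_neg u x y = max (- second_diff u x y) 0"

text \<open>The Bochner integral is used although it is \<open>0\<close> for non-integrable integrands: for an
  admissible \<open>\<phi>\<close> with \<open>0 < \<beta> < 2\<close>, and \<open>0 < \<alpha> < 2\<close>, the integrand is integrable as soon as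
  \<open>u\<close> is bounded, measurable and \<open>C\<^sup>2\<close> near \<open>x\<close>, which is the only situation in which the operator
  is evaluated in the viscosity definition below. The value at the single point \<open>y = 0\<close> is
  irrelevant.\<close>

definition extremal_min ::
  "real \<Rightarrow> real \<Rightarrow> real \<Rightarrow> (real \<Rightarrow> real) \<Rightarrow> ('a::euclidean_space \<Rightarrow> real) \<Rightarrow> 'a \<Rightarrow> real" where
  "extremal_min lam \<Lambda> \<alpha> \<phi> u x =
     (LINT y|lebesgue.
        lam * second_diff_pos u x y / norm y ^ DIM('a) * ((2 - \<alpha>) / norm y powr \<alpha>)
      - \<Lambda> * second_diff_neg u x y / norm y ^ DIM('a) *
          ((2 - \<alpha>) / norm y powr \<alpha> + \<phi> (1 / norm y)))"

definition C2_function :: "('a::euclidean_space \<Rightarrow> real) \<Rightarrow> bool" where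
  "C2_function f \<longleftrightarrow>
     (\<exists>(f' :: 'a \<Rightarrow> 'a \<Rightarrow>\<^sub>L real) (f'' :: 'a \<Rightarrow> 'a \<Rightarrow>\<^sub>L ('a \<Rightarrow>\<^sub>L real)).
        (\<forall>x. (f has_derivative blinfun_apply (f' x)) (at x)) \<and>
        (\<forall>x. (f' has_derivative blinfun_apply (f'' x)) (at x)) \<and>
        continuous_on UNIV f'')"

text \<open>Lower semicontinuity of the restriction of \<open>u\<close> to \<open>S\<close>.\<close>

definition lsc_on :: "'a::topological_space set \<Rightarrow> ('a \<Rightarrow> real) \<Rightarrow> bool" where
  "lsc_on S u \<longleftrightarrow> (\<forall>x\<in>S. \<forall>a<u x. \<forall>\<^sub>F y in at x within S. a < u y)"

text \<open>\<open>I u \<le> g\<close> in \<open>\<Omega>\<close> in the viscosity sense. Global measurability of \<open>u\<close> is what makes the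
  nonlocal expression \<open>I v x\<close> meaningful. The condition \<open>N \<Subset> \<Omega>\<close> is rendered as
  \<open>closure N\<close> being a compact subset of \<open>\<Omega>\<close>.\<close>

definition viscosity_supersolution ::
  "(('a::euclidean_space \<Rightarrow> real) \<Rightarrow> 'a \<Rightarrow> real) \<Rightarrow> ('a \<Rightarrow> real) \<Rightarrow> 'a set \<Rightarrow> ('a \<Rightarrow> real) \<Rightarrow> bool" where
  "viscosity_supersolution I g \<Omega> u \<longleftrightarrow>
     open \<Omega> \<and> bounded (range u) \<and> u \<in> borel_measurable lebesgue \<and> lsc_on (closure \<Omega>) u \<and>
     (\<forall>x\<in>\<Omega>. \<forall>\<psi> N.
        C2_function \<psi> \<and> open N \<and> x \<in> N \<and> compact (closure N) \<and> closure N \<subseteq> \<Omega> \<and>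
        (\<forall>z\<in>N. \<psi> z \<le> u z) \<and> \<psi> x = u x
        \<longrightarrow> I (\<lambda>z. if z \<in> N then \<psi> z else u z) x \<le> g x)"

text \<open>The \<open>L\<^sup>q\<close> (quasi-)norm, \<open>q > 0\<close>; for \<open>q < 1\<close> it is not a norm. It is only applied to
  bounded measurable functions on balls, where the integral is finite.\<close>

definition Lq_norm :: "real \<Rightarrow> 'a::euclidean_space set \<Rightarrow> ('a \<Rightarrow> real) \<Rightarrow> real" where
  "Lq_norm q S u = (LINT x:S|lebesgue. \<bar>u x\<bar> powr q) powr (1 / q)"

end

theory Submission
  imports Defs
begin

text \<open>For fixed \<open>\<alpha> < 2\<close> no covering or ABP argument is needed, and \<open>\<epsilon> = 1\<close> works. Let \<open>k > u 0\<close>. Since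
  \<open>u \<ge> 0\<close>, a vertical translate of \<open>- k |z|\<^sup>2 / r\<^sup>2\<close> touches \<open>u\<close> globally from below at some \<open>x\<^sub>0\<close> with
  \<open>|x\<^sub>0| < r\<close> and \<open>u x\<^sub>0 < k\<close>. At \<open>x\<^sub>0\<close> one has \<open>\<delta>\<^sup>- \<le> 2 k min (|y|\<^sup>2 / r\<^sup>2) 1\<close>, so the negative part of the
  operator is at most a multiple of \<open>k / r powr \<alpha>\<close>; the equation then bounds the positive part, whose kernel
  is at least a multiple of \<open>1 / r powr (d + \<alpha>)\<close> for \<open>|y| < 2 r\<close>. This gives
  \<open>\<integral>\<^sub>B u \<le> C r^d (u 0 + C\<^sub>0 r powr \<alpha>)\<close> on \<open>B = B\<^sub>r\<close>, and both claims follow from the Markov and Cauchy--Schwarz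
  inequalities.\<close>

section \<open>Lebesgue measurability and integrals under translation and inversion of the
  norm\<close>

text \<open>Used at the touching point \<open>x\<^sub>0\<close>: an integral over increments
  \<open>y\<close> becomes one over positions \<open>x\<^sub>0 + y\<close>, and
  \<open>y \<mapsto> v (x\<^sub>0 - y)\<close> is seen to be measurable.\<close>

lemma lebesgue_translation_distr:
  fixes a :: "'a::euclidean_space"
  shows "(\<lambda>y. a + y) \<in> lebesgue \<rightarrow>\<^sub>M lebesgue" "distr lebesgue lebesgue (\<lambda>y. a + y) = lebesgue"
    "(\<lambda>y. a - y) \<in> lebesgue \<rightarrow>\<^sub>M lebesgue"
proof -
  \<comment> \<open>The affine rules below act coordinate by coordinate; equal coefficients
    \<open>c\<close> reduce them to \<open>a + c *\<^sub>R x\<close>, with \<open>c = 1\<close> for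
    the translation and \<open>c = -1\<close> for the reflection.\<close>
  have eq: "a + (\<Sum>j\<in>Basis. (c * (x \<bullet> j)) *\<^sub>R j) = a + c *\<^sub>R x" for x :: 'a and c :: real
    unfolding scaleR_scaleR[symmetric] scaleR_sum_right[symmetric] euclidean_representation ..
  show 1: "(\<lambda>y. a + y) \<in> lebesgue \<rightarrow>\<^sub>M lebesgue"
    using lebesgue_affine_measurable[of "\<lambda>_. 1" a] eq[of 1] by simp
  show "(\<lambda>y. a - y) \<in> lebesgue \<rightarrow>\<^sub>M lebesgue"
    using lebesgue_affine_measurable[of "\<lambda>_. -1" a] eq[of "-1"] by simp
  have "lebesgue = density (distr lebesgue lebesgue (\<lambda>y. a + y)) (\<lambda>_. 1)"
    using lebesgue_affine_euclidean[of "\<lambda>_. 1" a] eq[of 1] by simp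
  then show "distr lebesgue lebesgue (\<lambda>y. a + y) = lebesgue"
    by (simp add: density_1)
qed

text \<open>A null set \<open>N\<close> has null preimage under \<open>y \<mapsto> s / |y|\<close> for almost every \<open>s\<close>, by Fubini, and the
  preimages for different \<open>s > 0\<close> are dilates of each other.\<close>

lemma AE_inverse_norm:
  assumes "AE t in lborel. P (t::real)"
  shows "AE y::'a::euclidean_space in lebesgue. P (1 / norm y)"
proof -
  obtain N where N: "N \<in> null_sets lborel" "{t. \<not> P t} \<subseteq> N"
    using assms by (auto elim!: AE_E simp: null_sets_def)
  then have [measurable]: "N \<in> sets borel" by auto
  have N0: "emeasure lebesgue N = 0"
    using null_sets_completionI[OF N(1)] by (rule null_setsD1)
  \<comment> \<open>For fixed \<open>y\<close> the exceptional \<open>s\<close> form the dilate of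
    \<open>N\<close> by \<open>norm y\<close>, which is again null.\<close>
  have "AE s in lborel. s / norm y \<notin> N" if "y \<noteq> 0" for y :: 'a
  proof -
    have "{s. s / norm y \<in> N} = (\<lambda>s. norm y *\<^sub>R s + 0) ` N"
    proof safe
      fix s assume "s / norm y \<in> N"
      then show "s \<in> (\<lambda>s. norm y *\<^sub>R s + 0) ` N"
        using that by (intro image_eqI[of _ _ "s / norm y"]) auto
    qed (use that in auto)
    then have "emeasure lebesgue {s. s / norm y \<in> N} = 0"
      using emeasure_lebesgue_affine[of "norm y" 0 N] N0 by simp
    moreover have "{s. s / norm y \<in> N} \<in> sets lborel" by measurable
    ultimately show ?thesis
      by (intro AE_I[of _ _ "{s. s / norm y \<in> N}"]) auto
  qed
  moreover have "AE y in lborel. y \<noteq> (0::'a)"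
    by (rule AE_lborel_singleton)
  ultimately have "AE y in lborel. AE s in lborel. s / norm (y::'a) \<notin> N"
    by auto
  then have "AE s in lborel. AE y in lborel. s / norm (y::'a) \<notin> N"
    by (subst (asm) lborel_pair.AE_commute) measurable
  then obtain N' where N': "\<And>s. s \<in> space lborel - N' \<Longrightarrow> AE y in lborel. s / norm (y::'a) \<notin> N"
      "N' \<in> null_sets lborel"
    by (rule AE_E3) blast
  \<comment> \<open>\<open>{1..2}\<close> has positive measure, so the null set \<open>N'\<close>
    misses some \<open>s\<close> in it; such an \<open>s\<close> is positive, as the final dilation
    requires.\<close>
  have "\<not> {1..2::real} \<subseteq> N'"
  proof
    assume "{1..2} \<subseteq> N'"
    then have "emeasure lborel {1..2::real} \<le> emeasure lborel N'"
      using N' by (intro emeasure_mono) auto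
    with N' show False by auto
  qed
  then obtain s where "s \<in> {1..2}" "s \<notin> N'" by blast
  then have s: "1 \<le> s" "s \<notin> N'" by simp_all
  with N' have sN: "AE y in lborel. s / norm (y::'a) \<notin> N" by simp
  let ?E = "{y::'a. s / norm y \<in> N}"
  have "?E \<in> sets lborel" by measurable
  with sN have "?E \<in> null_sets lborel"
    by (simp only: AE_iff_null_sets mem_Collect_eq)
  then have E0: "emeasure lebesgue ?E = 0"
    by (rule null_setsD1[OF null_sets_completionI])
  have "{y::'a. 1 / norm y \<in> N} = (\<lambda>y. (1/s) *\<^sub>R y + 0) ` ?E"
  proof (safe)
    fix y :: 'a assume "1 / norm y \<in> N"
    then show "y \<in> (\<lambda>y. (1/s) *\<^sub>R y + 0) ` ?E"
      using s by (intro image_eqI[of _ _ "s *\<^sub>R y"]) auto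
  qed (use s in auto)
  then have "emeasure lebesgue {y::'a. 1 / norm y \<in> N} = 0"
    using emeasure_lebesgue_affine[of "1/s" 0 ?E] E0 by simp
  moreover have "{y::'a. 1 / norm y \<in> N} \<in> sets lborel" by measurable
  ultimately show ?thesis
    using N by (intro AE_I[of _ _ "{y::'a. 1 / norm y \<in> N}"]) auto
qed

text \<open>Lebesgue measurability need not survive composition with a continuous map. Here
  \<open>f\<close> is replaced by a Borel function \<open>g\<close> equal to it almost everywhere on
  the half-line, and \<open>AE_inverse_norm\<close> carries the exceptional set over.\<close>

lemma measurable_inverse_norm:
  fixes f :: "real \<Rightarrow> real"
  assumes "f \<in> borel_measurable (lebesgue_on {0<..})"
  shows "(\<lambda>y::'a::euclidean_space. f (1 / norm y)) \<in> borel_measurable lebesgue"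
proof -
  have "(\<lambda>t. indicator {0<..} t *\<^sub>R f t) \<in> borel_measurable lebesgue"
    using assms by (subst (asm) borel_measurable_restrict_space_iff) auto
  then obtain g where [measurable]: "g \<in> borel_measurable lborel"
    and g: "AE t in lborel. indicator {0<..} t *\<^sub>R f t = g t"
    using completion_ex_borel_measurable_real by blast
  have "AE y::'a in lebesgue. indicator {0<..} (1 / norm y) *\<^sub>R f (1 / norm y) = g (1 / norm y)"
    using AE_inverse_norm[OF g] .
  \<comment> \<open>At \<open>y = 0\<close> the quotient \<open>1 / norm y\<close> is
    \<open>0\<close>, outside the half-line on which \<open>f\<close> is controlled.\<close>
  moreover have "AE y in lebesgue. y \<noteq> (0::'a)"
    by (intro AE_completion AE_lborel_singleton)
  ultimately have "AE y::'a in lebesgue. g (1 / norm y) = f (1 / norm y)"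
    by eventually_elim (auto simp: indicator_def)
  moreover have "(\<lambda>y::'a. g (1 / norm y)) \<in> borel_measurable lebesgue"
    by (rule measurable_completion) measurable
  ultimately show ?thesis
    by (rule borel_measurable_AE[rotated])
qed

text \<open>The doubling condition bounds \<open>f (1 / |y|)\<close> by an average of \<open>f\<close> over \<open>{1 / (2 |y|)..1 / |y|}\<close>;
  Tonelli then replaces integration in polar coordinates.\<close>

lemma nn_integral_inverse_norm_le:
  fixes f :: "real \<Rightarrow> ennreal" and A :: real
  assumes f: "f \<in> borel_measurable (lebesgue_on {0<..})"
    and A: "\<And>s t. 0 < t \<Longrightarrow> t \<le> s \<Longrightarrow> s \<le> 2 * t \<Longrightarrow> f s \<le> ennreal A * f t"
  shows "(\<integral>\<^sup>+ y. f (1 / norm y) * ennreal (1 / norm y ^ DIM('a)) \<partial>(lebesgue::'a::euclidean_space measure))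
    \<le> ennreal (2 * 2 ^ DIM('a) * unit_ball_vol DIM('a)) * ennreal A * (\<integral>\<^sup>+ t. f t * ennreal (1 / t) * indicator {0<..} t \<partial>lebesgue)"
    (is "?L \<le> _ * ?R")
proof -
  let ?d = "DIM('a)"
  define h where "h t = indicator {0<..} t * (f t * ennreal (1 / t))" for t :: real
  have "(\<lambda>t. f t * ennreal (1 / t)) \<in> borel_measurable (lebesgue_on {0<..})"
    by (intro borel_measurable_times_ennreal[OF f] measurable_restrict_space1 measurable_completion; measurable)
  then have mh: "h \<in> borel_measurable lebesgue"
    unfolding h_def by (subst (asm) borel_measurable_restrict_space_iff_ennreal) (simp_all add: mult.commute)
  from completion_ex_borel_measurable[OF this]
  obtain g where [measurable]: "g \<in> borel_measurable lborel" and g: "AE t in lborel. h t = g t"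
    by (elim bexE)
  \<comment> \<open>\<open>I\<close> marks the averaging window in \<open>t\<close> for given
    \<open>y\<close>. For given \<open>t > 0\<close> it marks the shell of all \<open>y\<close> with
    \<open>1 / (2 * t) \<le> norm y \<le> 1 / t\<close>, and this is the view taken after the
    integrals are exchanged.\<close>
  define I where "I y t = (indicator {(y,t). 1 / (2 * norm y) \<le> t \<and> t \<le> 1 / norm y} (y, t) :: ennreal)"
    for y :: 'a and t :: real
  have [measurable]: "case_prod I \<in> borel_measurable (lborel \<Otimes>\<^sub>M lborel)"
    unfolding I_def by measurable
  define J where "J y = ennreal (1 / norm y ^ ?d)" for y :: 'a
  have [measurable]: "J \<in> borel_measurable lborel"
    unfolding J_def by measurable
  have 1: "f (1 / norm y) * J y \<le> 2 * ennreal A * (\<integral>\<^sup>+ t. g t * (I y t * J y) \<partial>lborel)" for y :: 'a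
  proof (cases "y = 0")
    case True
    then show ?thesis by (simp add: J_def zero_power)
  next
    case False
    let ?a = "1 / (2 * norm y)" and ?b = "1 / norm y"
    have ab: "0 < ?a" "?a \<le> ?b" "?b - ?a = 1 / (2 * norm y)"
      using False by (auto simp: field_simps)
    \<comment> \<open>The window has length \<open>1 / (2 * norm y)\<close>, so \<open>f ?b\<close>
      is twice the integral over it of the constant \<open>f ?b * norm y\<close>. On the window
      \<open>norm y \<le> 1 / t\<close>, which produces the weight \<open>1 / t\<close>.\<close>
    have "f ?b = 2 * (f ?b * ennreal (norm y) * ennreal (1 / (2 * norm y)))"
    proof -
      have "2 * (ennreal (norm y) * ennreal (1 / (2 * norm y))) = 1"
      proof -
        have "ennreal 2 * (ennreal (norm y) * ennreal (1 / (2 * norm y))) = ennreal (2 * (norm y * (1 / (2 * norm y))))"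
          by (simp only: ennreal_mult'' norm_ge_zero zero_le_mult_iff zero_le_divide_iff zero_le_numeral zero_le_one simp_thms)
        also have "2 * (norm y * (1 / (2 * norm y))) = 1"
          using False by simp
        finally show ?thesis by simp
      qed
      then show ?thesis by (metis mult.assoc mult.left_commute mult.right_neutral)
    qed
    also have "\<dots> = 2 * (\<integral>\<^sup>+ t. f ?b * ennreal (norm y) * indicator {?a..?b} t \<partial>lborel)"
      using ab by (simp add: nn_integral_cmult_indicator)
    also have "\<dots> \<le> 2 * (\<integral>\<^sup>+ t. ennreal A * (g t * I y t) \<partial>lborel)"
    proof (intro mult_left_mono nn_integral_mono_AE)
      show "AE t in lborel. f ?b * ennreal (norm y) * indicator {?a..?b} t \<le> ennreal A * (g t * I y t)"
        using g
      proof eventually_elim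
        case (elim t)
        show ?case
        proof (cases "t \<in> {?a..?b}")
          case True
          then have t: "0 < t" "t \<le> ?b" "?b \<le> 2 * t"
            using less_le_trans[OF ab(1), of t] by (simp_all add: pos_divide_le_eq mult.commute mult.left_commute)
          have "norm y \<le> 1 / t"
            using t False by (simp add: pos_le_divide_eq mult.commute)
          have "f ?b * ennreal (norm y) \<le> (ennreal A * f t) * ennreal (1 / t)"
            using A[OF t] \<open>norm y \<le> 1 / t\<close> by (intro mult_mono ennreal_leI) simp_all
          also have "\<dots> = ennreal A * g t"
            using t elim[symmetric] by (simp add: h_def mult.assoc)
          finally show ?thesis
            using True by (simp add: I_def)
        qed simp
      qed
    qed simp
    finally have "f ?b \<le> 2 * (ennreal A * (\<integral>\<^sup>+ t. g t * I y t \<partial>lborel))"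
      by (subst (asm) nn_integral_cmult) measurable
    then have "f ?b * J y \<le> 2 * (ennreal A * (\<integral>\<^sup>+ t. g t * I y t \<partial>lborel)) * J y"
      by (rule mult_right_mono) simp
    also have "\<dots> = 2 * ennreal A * (\<integral>\<^sup>+ t. g t * (I y t * J y) \<partial>lborel)"
    proof -
      have "(\<integral>\<^sup>+ t. g t * I y t \<partial>lborel) * J y = (\<integral>\<^sup>+ t. g t * I y t * J y \<partial>lborel)"
        by (rule nn_integral_multc[symmetric]) measurable
      then show ?thesis by (simp only: mult.assoc)
    qed
    finally show ?thesis .
  qed
  \<comment> \<open>On the shell \<open>J y\<close> is at most \<open>(2 * t) ^ ?d\<close>, and the
    shell lies in a ball of radius \<open>1 / t\<close>; the powers of \<open>t\<close>
    cancel.\<close>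
  have 2: "(\<integral>\<^sup>+ y. I y t * J y \<partial>lborel) \<le> ennreal (2 ^ ?d * unit_ball_vol ?d)" if "0 < t" for t
  proof -
    have "(\<integral>\<^sup>+ y. I y t * J y \<partial>lborel) \<le> (\<integral>\<^sup>+ y. ennreal ((2 * t) ^ ?d) * indicator (cball 0 (1 / t)) (y::'a) \<partial>lborel)"
    proof (rule nn_integral_mono)
      fix y :: 'a
      show "I y t * J y \<le> ennreal ((2 * t) ^ ?d) * indicator (cball 0 (1 / t)) y"
      proof (cases "y \<noteq> 0 \<and> I y t \<noteq> 0")
        case True
        then have y: "1 / (2 * norm y) \<le> t" "t \<le> 1 / norm y" "0 < norm y"
          by (auto simp: I_def indicator_def split: if_splits)
        then have "1 / norm y \<le> 2 * t" "norm y \<le> 1 / t"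
          using that by (auto simp: field_simps)
        then have "(1 / norm y) ^ ?d \<le> (2 * t) ^ ?d"
          by (intro power_mono) auto
        with y \<open>norm y \<le> 1 / t\<close> show ?thesis
          by (auto simp: I_def J_def power_divide intro!: ennreal_leI)
      qed (auto simp: J_def zero_power)
    qed
    also have "\<dots> = ennreal ((2 * t) ^ ?d) * ennreal (unit_ball_vol ?d * (1 / t) ^ ?d)"
      using that by (simp add: nn_integral_cmult_indicator emeasure_cball)
    also have "\<dots> = ennreal (2 ^ ?d * unit_ball_vol ?d)"
      using that by (simp flip: ennreal_mult add: power_mult_distrib power_divide)
    finally show ?thesis .
  qed
  have "(\<integral>\<^sup>+ y. \<integral>\<^sup>+ t. g t * (I y t * J y) \<partial>lborel \<partial>lborel)
      = (\<integral>\<^sup>+ t. \<integral>\<^sup>+ y. g t * (I y t * J y) \<partial>lborel \<partial>lborel)"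
    by (rule lborel_pair.Fubini') measurable
  also have "\<dots> = (\<integral>\<^sup>+ t. g t * (\<integral>\<^sup>+ y. I y t * J y \<partial>lborel) \<partial>lborel)"
    by (intro nn_integral_cong nn_integral_cmult) measurable
  also have "\<dots> \<le> (\<integral>\<^sup>+ t. h t * ennreal (2 ^ ?d * unit_ball_vol ?d) \<partial>lborel)"
  proof (intro nn_integral_mono_AE)
    show "AE t in lborel. g t * (\<integral>\<^sup>+ y. I y t * J y \<partial>lborel) \<le> h t * ennreal (2 ^ ?d * unit_ball_vol ?d)"
      using g
    proof eventually_elim
      case (elim t)
      show ?case
      proof (cases "0 < t")
        case True
        then show ?thesis unfolding elim using 2 by (intro mult_left_mono) auto
      next
        case False
        then have "g t = 0" using elim[symmetric] by (simp add: h_def)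
        then show ?thesis by simp
      qed
    qed
  qed
  also have "\<dots> = (\<integral>\<^sup>+ t. h t \<partial>lebesgue) * ennreal (2 ^ ?d * unit_ball_vol ?d)"
    using nn_integral_multc[OF mh] by (metis nn_integral_completion)
  also have "(\<integral>\<^sup>+ t. h t \<partial>lebesgue) = ?R"
    unfolding h_def by (intro nn_integral_cong) (rule mult.commute)
  finally have 3: "(\<integral>\<^sup>+ y. \<integral>\<^sup>+ t. g t * (I y t * J y) \<partial>lborel \<partial>lborel) \<le> ?R * ennreal (2 ^ ?d * unit_ball_vol ?d)" .
  have "?L \<le> (\<integral>\<^sup>+ y. 2 * ennreal A * (\<integral>\<^sup>+ t. g t * (I y t * J y) \<partial>lborel) \<partial>lebesgue)"
    unfolding J_def[symmetric] by (intro nn_integral_mono 1)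
  also have "\<dots> = 2 * ennreal A * (\<integral>\<^sup>+ y. \<integral>\<^sup>+ t. g t * (I y t * J y) \<partial>lborel \<partial>lborel)"
    by (simp add: nn_integral_completion nn_integral_cmult)
  also have "\<dots> \<le> 2 * ennreal A * (?R * ennreal (2 ^ ?d * unit_ball_vol ?d))"
    by (intro mult_left_mono 3) simp
  also have "\<dots> = ennreal (2 * 2 ^ ?d * unit_ball_vol ?d) * ennreal A * ?R"
  proof -
    have "ennreal (2 * 2 ^ ?d * unit_ball_vol ?d) = 2 * ennreal (2 ^ ?d * unit_ball_vol ?d)"
      by (subst mult.assoc, subst ennreal_mult) auto
    then show ?thesis by (simp only: mult_ac)
  qed
  finally show ?thesis .
qed

section \<open>Growth of the weight and the integral of the kernel majorant\<close>

text \<open>The scaling condition with ratio \<open>s / t\<close> in \<open>{1..2}\<close>; the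
  factor \<open>4\<close> bounds \<open>2 powr \<beta>\<close> because \<open>\<beta> < 2\<close>.
  It supplies the doubling hypothesis of \<open>nn_integral_inverse_norm_le\<close>.\<close>

lemma admissible_weight_double:
  assumes "admissible_weight \<beta> \<kappa> \<phi>" "0 < \<kappa>" "0 < \<beta>" "\<beta> < 2" "0 < t" "t \<le> s" "s \<le> 2 * t"
  shows "\<phi> s \<le> 4 * \<kappa> * \<phi> t"
proof -
  have pos: "0 < \<phi> t"
    using assms by (auto simp: admissible_weight_def)
  have "\<phi> s = \<phi> ((s / t) * t)"
    using assms by simp
  also have "\<dots> \<le> \<kappa> * (s / t) powr \<beta> * \<phi> t"
    using assms unfolding admissible_weight_def by (metis le_divide_eq_1_pos)
  also have "\<dots> \<le> \<kappa> * 4 * \<phi> t"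
  proof -
    have "(s / t) powr \<beta> \<le> 2 powr \<beta>"
      using assms by (intro powr_mono2) (auto simp: field_simps)
    also have "\<dots> \<le> 2 powr 2"
      using assms by (intro powr_mono) auto
    finally show ?thesis
      using assms pos by (intro mult_right_mono mult_left_mono) auto
  qed
  finally show ?thesis by (simp add: mult_ac)
qed

text \<open>Large \<open>t\<close> corresponds to small increments. There the weight is no more
  singular than the stable kernel, so the quadratic decay of the cutoff suffices for
  integrability.\<close>

lemma admissible_weight_le_powr:
  assumes "admissible_weight \<beta> \<kappa> \<phi>" "0 < \<kappa>" "\<beta> \<le> \<alpha>" "1 \<le> t"
  shows "\<phi> t \<le> \<kappa> * \<phi> 1 * t powr \<alpha>"
proof -
  have pos: "0 < \<phi> 1"
    using assms by (auto simp: admissible_weight_def)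
  have "\<phi> t = \<phi> (t * 1)" by simp
  also have "\<dots> \<le> \<kappa> * t powr \<beta> * \<phi> 1"
    using assms unfolding admissible_weight_def by (metis zero_less_one)
  also have "\<dots> \<le> \<kappa> * t powr \<alpha> * \<phi> 1"
    using assms pos by (intro mult_right_mono mult_left_mono powr_mono) auto
  finally show ?thesis by (simp add: mult_ac)
qed

text \<open>The profile of \<open>kernel_majorant\<close> in the variable
  \<open>t = 1 / norm y\<close>, without the factor \<open>1 / norm y ^ DIM('a)\<close>.\<close>

definition radial_majorant :: "real \<Rightarrow> (real \<Rightarrow> real) \<Rightarrow> real \<Rightarrow> real \<Rightarrow> real" where
  "radial_majorant \<alpha> \<phi> r t = min ((1 / (r * t))\<^sup>2) 1 * ((2 - \<alpha>) * t powr \<alpha> + \<phi> t)"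

text \<open>On \<open>t < 1\<close> the weight is handled by its integrability condition. What
  remains is a multiple of \<open>t powr \<alpha>\<close>; the cutoff splits it at
  \<open>1 / r\<close> into integrals of \<open>t powr (\<alpha> - 1)\<close> below and of
  \<open>t powr (\<alpha> - 3) / r\<^sup>2\<close> above, finite since
  \<open>0 < \<alpha> < 2\<close> and both proportional to \<open>r powr - \<alpha>\<close>.\<close>

lemma nn_integral_radial_majorant_le:
  assumes adm: "admissible_weight \<beta> \<kappa> \<phi>" and par: "0 < \<kappa>" "0 < \<beta>" "\<beta> < \<alpha>" "\<alpha> < 2"
  shows "\<exists>M>0. \<forall>r. 0 < r \<and> r \<le> 1 \<longrightarrow>
    (\<integral>\<^sup>+ t. ennreal (radial_majorant \<alpha> \<phi> r t) * ennreal (1 / t) * indicator {0<..} t \<partial>lebesgue)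
      \<le> ennreal (M * r powr - \<alpha>)"
proof -
  define I where "I = (LINT t|lebesgue. indicator {0<..<1} t *\<^sub>R (\<phi> t / t))"
  define M0 where "M0 = 2 - \<alpha> + \<kappa> * \<phi> 1"
  define M where "M = I + M0 * (1 / \<alpha> + 1 / (2 - \<alpha>))"
  have phi: "0 < \<phi> t" if "0 < t" for t
    using adm that by (auto simp: admissible_weight_def)
  have M0: "0 < M0"
    unfolding M0_def using par phi[of 1] by (intro add_pos_pos) auto
  have int: "integrable lebesgue (\<lambda>t. indicator {0<..<1} t *\<^sub>R (\<phi> t / t))"
    using adm by (simp add: admissible_weight_def set_integrable_def)
  have nonneg: "0 \<le> indicator {0<..<1} t *\<^sub>R (\<phi> t / t)" for t :: real
    using phi[of t] by (auto simp: indicator_def)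
  have I0: "0 \<le> I"
    unfolding I_def using nonneg by (intro Bochner_Integration.integral_nonneg) auto
  have I: "(\<integral>\<^sup>+ t. ennreal (indicator {0<..<1} t *\<^sub>R (\<phi> t / t)) \<partial>lebesgue) = ennreal I"
    unfolding I_def using nonneg by (intro nn_integral_eq_integral int) auto
  have "0 < M"
    unfolding M_def using I0 M0 par by (intro add_nonneg_pos mult_pos_pos add_pos_pos) auto
  moreover have "(\<integral>\<^sup>+ t. ennreal (radial_majorant \<alpha> \<phi> r t) * ennreal (1 / t) * indicator {0<..} t \<partial>lebesgue)
      \<le> ennreal (M * r powr - \<alpha>)" if r: "0 < r" "r \<le> 1" for r
  proof -
    \<comment> \<open>Here \<open>r \<le> 1\<close> enters: it lets the constant \<open>I\<close>,
      which does not scale with \<open>r\<close>, be absorbed into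
      \<open>I * r powr - \<alpha>\<close>.\<close>
    have rp: "1 \<le> r powr - \<alpha>"
      using r par by (simp add: powr_minus powr_le1 one_le_inverse)
    have J1: "(\<integral>\<^sup>+ t. ennreal (t powr (\<alpha> - 1)) * indicator {0..1/r} t \<partial>lebesgue) = ennreal (r powr - \<alpha> / \<alpha>)"
      unfolding nn_integral_completion
      using nn_integral_has_integral_lebesgue'[OF _ has_integral_powr_from_0[of "\<alpha> - 1" "1 / r"]] r par
      by (simp add: powr_divide powr_minus_divide)
    have J2: "(\<integral>\<^sup>+ t. ennreal (t powr (\<alpha> - 3)) * indicator {1/r..} t \<partial>lebesgue)
        = ennreal (r\<^sup>2 * r powr - \<alpha> / (2 - \<alpha>))"
    proof -
      have "- ((1 / r) powr (\<alpha> - 3 + 1)) / (\<alpha> - 3 + 1) = r\<^sup>2 * r powr - \<alpha> / (2 - \<alpha>)"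
      proof -
        have "(1 / r) powr (\<alpha> - 3 + 1) = r powr (2 - \<alpha>)"
          using r by (simp add: powr_divide flip: powr_minus_divide)
        also have "\<dots> = r\<^sup>2 * r powr - \<alpha>"
          using r by (simp add: powr_add[of r 2 "-\<alpha>", simplified])
        finally show ?thesis using par by (simp add: divide_simps) (simp add: algebra_simps)
      qed
      then show ?thesis
        unfolding nn_integral_completion
        using nn_integral_has_integral_lebesgue'[OF _ has_integral_powr_to_inf[of "\<alpha> - 3" "1 / r"]] r par
        by simp
    qed
    have le: "ennreal (radial_majorant \<alpha> \<phi> r t) * ennreal (1 / t) * indicator {0<..} t
      \<le> ennreal (indicator {0<..<1} t *\<^sub>R (\<phi> t / t)) + (ennreal M0 * (ennreal (t powr (\<alpha> - 1)) * indicator {0..1/r} t)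
       + ennreal (M0 / r\<^sup>2) * (ennreal (t powr (\<alpha> - 3)) * indicator {1/r..} t))" for t
    proof (cases "0 < t")
      case t: True
      let ?m = "min ((1 / (r * t))\<^sup>2) 1"
      \<comment> \<open>\<open>M0\<close> adds the coefficient \<open>2 - \<alpha>\<close> of the
        pure power to the coefficient \<open>\<kappa> * \<phi> 1\<close> of the growth bound that
        replaces \<open>\<phi> t\<close> for \<open>t \<ge> 1\<close>.\<close>
      have a: "(2 - \<alpha>) * t powr \<alpha> + \<phi> t \<le> indicator {0<..<1} t * \<phi> t + M0 * t powr \<alpha>"
        using t par admissible_weight_le_powr[OF adm, of \<alpha> t] phi[of 1]
        by (cases "t < 1") (auto simp: M0_def algebra_simps)
      have m: "0 \<le> ?m" "?m \<le> 1" by auto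
      have "radial_majorant \<alpha> \<phi> r t * (1 / t) \<le> ?m * (indicator {0<..<1} t * \<phi> t + M0 * t powr \<alpha>) * (1 / t)"
        unfolding radial_majorant_def using t m a by (intro mult_right_mono mult_left_mono) auto
      also have "\<dots> = ?m * (indicator {0<..<1} t * \<phi> t / t) + M0 * (?m * t powr (\<alpha> - 1))"
        using t by (simp add: field_simps powr_diff)
      also have "\<dots> \<le> indicator {0<..<1} t *\<^sub>R (\<phi> t / t) + M0 * (?m * t powr (\<alpha> - 1))"
        using mult_left_le_one_le[of "indicator {0<..<1} t * \<phi> t / t" ?m] m nonneg[of t] by simp
      finally have "radial_majorant \<alpha> \<phi> r t * (1 / t) \<le> \<dots>" .
      then have S: "ennreal (radial_majorant \<alpha> \<phi> r t * (1 / t))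
          \<le> ennreal (indicator {0<..<1} t *\<^sub>R (\<phi> t / t)) + ennreal M0 * ennreal (?m * t powr (\<alpha> - 1))"
        using nonneg[of t] m M0 by (simp flip: ennreal_plus ennreal_mult)
      have T: "ennreal (?m * t powr (\<alpha> - 1)) \<le> ennreal (t powr (\<alpha> - 1)) * indicator {0..1/r} t
        + ennreal (1 / r\<^sup>2) * (ennreal (t powr (\<alpha> - 3)) * indicator {1/r..} t)"
      proof (cases "t \<le> 1 / r")
        case True
        then show ?thesis
          using t m by (intro add_increasing2) (auto intro!: ennreal_leI mult_left_le_one_le)
      next
        case False
        have "?m * t powr (\<alpha> - 1) \<le> (1 / (r * t))\<^sup>2 * t powr (\<alpha> - 1)"
          by (intro mult_right_mono) auto
        also have "\<dots> = 1 / r\<^sup>2 * t powr (\<alpha> - 3)"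
          using t r by (simp add: powr_diff power2_eq_square power3_eq_cube field_simps)
        finally show ?thesis
          using False by (simp add: ennreal_leI flip: ennreal_mult)
      qed
      have "ennreal (radial_majorant \<alpha> \<phi> r t) * ennreal (1 / t) * indicator {0<..} t
          = ennreal (radial_majorant \<alpha> \<phi> r t * (1 / t))"
        using t by (simp add: ennreal_mult''[symmetric])
      also note S
      also have "ennreal (indicator {0<..<1} t *\<^sub>R (\<phi> t / t)) + ennreal M0 * ennreal (?m * t powr (\<alpha> - 1))
        \<le> ennreal (indicator {0<..<1} t *\<^sub>R (\<phi> t / t)) + ennreal M0 * (ennreal (t powr (\<alpha> - 1)) * indicator {0..1/r} t
        + ennreal (1 / r\<^sup>2) * (ennreal (t powr (\<alpha> - 3)) * indicator {1/r..} t))"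
        by (intro add_left_mono mult_left_mono T) simp
      also have "\<dots> = ennreal (indicator {0<..<1} t *\<^sub>R (\<phi> t / t)) + (ennreal M0 * (ennreal (t powr (\<alpha> - 1)) * indicator {0..1/r} t)
        + ennreal (M0 / r\<^sup>2) * (ennreal (t powr (\<alpha> - 3)) * indicator {1/r..} t))"
      proof -
        have "ennreal (M0 / r\<^sup>2) = ennreal M0 * ennreal (1 / r\<^sup>2)"
          by (simp add: ennreal_mult''[symmetric])
        then show ?thesis by (simp only: distrib_left mult.assoc)
      qed
      finally show ?thesis .
    qed simp
    have m0: "(\<lambda>t. ennreal (indicator {0<..<1} t *\<^sub>R (\<phi> t / t))) \<in> borel_measurable lebesgue"
      by (rule measurable_compose[OF borel_measurable_integrable[OF int] measurable_ennreal])
    have m1: "(\<lambda>t. ennreal (t powr (\<alpha> - 1)) * indicator {0..1/r} t) \<in> borel_measurable lebesgue"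
      by (rule measurable_completion) measurable
    have m2: "(\<lambda>t. ennreal (t powr (\<alpha> - 3)) * indicator {1/r..} t) \<in> borel_measurable lebesgue"
      by (rule measurable_completion) measurable
    have "(\<integral>\<^sup>+ t. ennreal (radial_majorant \<alpha> \<phi> r t) * ennreal (1 / t) * indicator {0<..} t \<partial>lebesgue)
      \<le> (\<integral>\<^sup>+ t. ennreal (indicator {0<..<1} t *\<^sub>R (\<phi> t / t)) + (ennreal M0 * (ennreal (t powr (\<alpha> - 1)) * indicator {0..1/r} t)
       + ennreal (M0 / r\<^sup>2) * (ennreal (t powr (\<alpha> - 3)) * indicator {1/r..} t)) \<partial>lebesgue)"
      by (rule nn_integral_mono) (rule le)
    also have "\<dots> = ennreal I + (ennreal M0 * ennreal (r powr - \<alpha> / \<alpha>) + ennreal (M0 / r\<^sup>2) * ennreal (r\<^sup>2 * r powr - \<alpha> / (2 - \<alpha>)))"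
      by (simp only: nn_integral_add nn_integral_cmult m0 m1 m2 borel_measurable_add
          borel_measurable_times_ennreal borel_measurable_const I J1 J2)
    also have "\<dots> = ennreal (I + M0 * (1 / \<alpha> + 1 / (2 - \<alpha>)) * r powr - \<alpha>)"
      using I0 M0 r par by (simp flip: ennreal_plus ennreal_mult) (simp add: field_simps)
    also have "\<dots> \<le> ennreal (M * r powr - \<alpha>)"
      using I0 rp by (intro ennreal_leI) (simp add: M_def distrib_right mult_le_cancel_left1)
    finally show ?thesis .
  qed
  ultimately show ?thesis by blast
qed

text \<open>Up to constant factors this dominates the integrand at the touching point: the cutoff
  \<open>min ((norm y / r)\<^sup>2) 1\<close> joins the quadratic bound for short increments to the
  uniform bound for long ones.\<close>

definition kernel_majorant :: "real \<Rightarrow> (real \<Rightarrow> real) \<Rightarrow> real \<Rightarrow> 'a::euclidean_space \<Rightarrow> real" where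
  "kernel_majorant \<alpha> \<phi> r y =
     min ((norm y / r)\<^sup>2) 1 / norm y ^ DIM('a) * ((2 - \<alpha>) / norm y powr \<alpha> + \<phi> (1 / norm y))"

lemma kernel_majorant_nonneg:
  assumes "admissible_weight \<beta> \<kappa> \<phi>" "\<alpha> < 2"
  shows "0 \<le> kernel_majorant \<alpha> \<phi> r y"
proof (cases "y = 0")
  case False
  then have "0 < \<phi> (1 / norm y)" using assms by (simp add: admissible_weight_def)
  then show ?thesis
    unfolding kernel_majorant_def using assms by (intro mult_nonneg_nonneg divide_nonneg_nonneg add_nonneg_nonneg) auto
qed (simp add: kernel_majorant_def)

text \<open>The substitution \<open>t = 1 / norm y\<close> carries the radial estimate over to
  space. Integrability is part of the conclusion because the Bochner integral in
  \<open>extremal_min\<close> can be split only into integrable parts.\<close>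

lemma integral_kernel_majorant_le:
  assumes adm: "admissible_weight \<beta> \<kappa> \<phi>" and par: "0 < \<kappa>" "0 < \<beta>" "\<beta> < \<alpha>" "\<alpha> < 2"
  shows "\<exists>M>0. \<forall>r. 0 < r \<and> r \<le> 1 \<longrightarrow>
    integrable lebesgue (kernel_majorant \<alpha> \<phi> r :: 'a::euclidean_space \<Rightarrow> real) \<and>
    (LINT y|lebesgue. kernel_majorant \<alpha> \<phi> r (y::'a)) \<le> M * r powr - \<alpha>"
proof -
  obtain M where M: "0 < M" "\<And>r. 0 < r \<Longrightarrow> r \<le> 1 \<Longrightarrow>
    (\<integral>\<^sup>+ t. ennreal (radial_majorant \<alpha> \<phi> r t) * ennreal (1 / t) * indicator {0<..} t \<partial>lebesgue)
      \<le> ennreal (M * r powr - \<alpha>)"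
    using nn_integral_radial_majorant_le[OF adm par] by blast
  define A where "A = 4 + 4 * \<kappa>"
  define M' where "M' = 2 * 2 ^ DIM('a) * unit_ball_vol DIM('a) * A * M"
  have A: "0 < A" using par by (simp add: A_def)
  have phi: "0 < \<phi> t" if "0 < t" for t
    using adm that by (auto simp: admissible_weight_def)
  have mphi: "\<phi> \<in> borel_measurable (lebesgue_on {0<..})"
    using adm by (simp add: admissible_weight_def)
  \<comment> \<open>The cutoff decreases in \<open>t\<close>, the power gains at most a factor
    \<open>4\<close> and the weight at most \<open>4 * \<kappa>\<close>; \<open>A\<close> is the sum
    of the two factors.\<close>
  have double: "radial_majorant \<alpha> \<phi> r s \<le> A * radial_majorant \<alpha> \<phi> r t"
    if "0 < t" "t \<le> s" "s \<le> 2 * t" "0 < r" for r s t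
  proof -
    have "(1 / (r * s))\<^sup>2 \<le> (1 / (r * t))\<^sup>2"
      using that by (intro power_mono divide_left_mono mult_left_mono) auto
    then have 1: "min ((1 / (r * s))\<^sup>2) 1 \<le> min ((1 / (r * t))\<^sup>2) 1"
      by linarith
    have "s powr \<alpha> \<le> (2 * t) powr \<alpha>"
      using that par by (intro powr_mono2) auto
    also have "\<dots> \<le> 2 powr 2 * t powr \<alpha>"
      using that par by (simp add: powr_mult) (intro mult_right_mono powr_mono[of \<alpha> 2 2, simplified], auto)
    finally have "(2 - \<alpha>) * s powr \<alpha> \<le> (2 - \<alpha>) * (4 * t powr \<alpha>)"
      using par by (intro mult_left_mono) auto
    moreover have "\<phi> s \<le> 4 * \<kappa> * \<phi> t"
      using that par by (intro admissible_weight_double[OF adm]) auto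
    moreover have "0 \<le> \<kappa> * ((2 - \<alpha>) * t powr \<alpha>)" "0 < \<phi> t"
      using par phi that by auto
    ultimately have 2: "(2 - \<alpha>) * s powr \<alpha> + \<phi> s \<le> A * ((2 - \<alpha>) * t powr \<alpha> + \<phi> t)"
      by (simp add: A_def algebra_simps)
    have "radial_majorant \<alpha> \<phi> r s \<le> min ((1 / (r * t))\<^sup>2) 1 * (A * ((2 - \<alpha>) * t powr \<alpha> + \<phi> t))"
      unfolding radial_majorant_def using 1 2 par phi[of s] that by (intro mult_mono) auto
    then show ?thesis by (simp add: radial_majorant_def mult_ac)
  qed
  have main: "(\<integral>\<^sup>+ y. ennreal (kernel_majorant \<alpha> \<phi> r (y::'a)) \<partial>lebesgue) \<le> ennreal (M' * r powr - \<alpha>)"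
    if r: "0 < r" "r \<le> 1" for r
  proof -
    have eq: "kernel_majorant \<alpha> \<phi> r y = radial_majorant \<alpha> \<phi> r (1 / norm y) * (1 / norm y ^ DIM('a))" for y :: 'a
      using r by (cases "y = 0") (simp_all add: kernel_majorant_def radial_majorant_def powr_divide)
    have nonneg: "0 \<le> radial_majorant \<alpha> \<phi> r t" if "0 < t" for t
      unfolding radial_majorant_def using phi[OF that] par by (intro mult_nonneg_nonneg add_nonneg_nonneg) auto
    have "(\<integral>\<^sup>+ y. ennreal (kernel_majorant \<alpha> \<phi> r (y::'a)) \<partial>lebesgue)
      = (\<integral>\<^sup>+ y. ennreal (radial_majorant \<alpha> \<phi> r (1 / norm y)) * ennreal (1 / norm (y::'a) ^ DIM('a)) \<partial>lebesgue)"
      unfolding eq by (intro nn_integral_cong ennreal_mult'') auto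
    also have "\<dots> \<le> ennreal (2 * 2 ^ DIM('a) * unit_ball_vol DIM('a)) * ennreal A *
      (\<integral>\<^sup>+ t. ennreal (radial_majorant \<alpha> \<phi> r t) * ennreal (1 / t) * indicator {0<..} t \<partial>lebesgue)"
    proof (intro nn_integral_inverse_norm_le)
      have "(\<lambda>t. min ((1 / (r * t))\<^sup>2) 1) \<in> borel_measurable (lebesgue_on {0<..})"
        "(\<lambda>t. (2 - \<alpha>) * t powr \<alpha>) \<in> borel_measurable (lebesgue_on {0<..})"
        by (intro measurable_restrict_space1 measurable_completion; measurable)+
      with mphi show "(\<lambda>t. ennreal (radial_majorant \<alpha> \<phi> r t)) \<in> borel_measurable (lebesgue_on {0<..})"
        unfolding radial_majorant_def by measurable
    next
      fix s t :: real assume "0 < t" "t \<le> s" "s \<le> 2 * t"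
      then show "ennreal (radial_majorant \<alpha> \<phi> r s) \<le> ennreal A * ennreal (radial_majorant \<alpha> \<phi> r t)"
        using double r A nonneg[of t] by (simp add: ennreal_leI flip: ennreal_mult)
    qed
    also have "\<dots> \<le> ennreal (2 * 2 ^ DIM('a) * unit_ball_vol DIM('a)) * ennreal A * ennreal (M * r powr - \<alpha>)"
      using M(2)[OF r] by (intro mult_left_mono) auto
    also have "\<dots> = ennreal (M' * r powr - \<alpha>)"
      using A M(1) by (simp add: M'_def mult_ac flip: ennreal_mult)
    finally show ?thesis .
  qed
  have "0 < M'"
    unfolding M'_def using A M(1) by simp
  moreover have "integrable lebesgue (kernel_majorant \<alpha> \<phi> r :: 'a \<Rightarrow> real) \<and>
    (LINT y|lebesgue. kernel_majorant \<alpha> \<phi> r (y::'a)) \<le> M' * r powr - \<alpha>" if r: "0 < r" "r \<le> 1" for r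
  proof
    have "(\<lambda>y::'a. min ((norm y / r)\<^sup>2) 1 / norm y ^ DIM('a)) \<in> borel_measurable lebesgue"
      "(\<lambda>y::'a. (2 - \<alpha>) / norm y powr \<alpha>) \<in> borel_measurable lebesgue"
      by (rule measurable_completion; measurable)+
    with measurable_inverse_norm[OF mphi]
    have m: "(kernel_majorant \<alpha> \<phi> r :: 'a \<Rightarrow> real) \<in> borel_measurable lebesgue"
      unfolding kernel_majorant_def by measurable
    have nn: "0 \<le> kernel_majorant \<alpha> \<phi> r y" for y :: 'a
      by (rule kernel_majorant_nonneg[OF adm par(4)])
    show "integrable lebesgue (kernel_majorant \<alpha> \<phi> r :: 'a \<Rightarrow> real)"
      using m nn main[OF r] by (intro integrableI_nonneg) (auto intro: le_less_trans)
    then have "ennreal (LINT y|lebesgue. kernel_majorant \<alpha> \<phi> r (y::'a)) \<le> ennreal (M' * r powr - \<alpha>)"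
      using main[OF r] nn by (subst (asm) nn_integral_eq_integral) auto
    then show "(LINT y|lebesgue. kernel_majorant \<alpha> \<phi> r (y::'a)) \<le> M' * r powr - \<alpha>"
      using \<open>0 < M'\<close> by (simp add: ennreal_le_iff)
  qed
  ultimately show ?thesis by blast
qed

section \<open>Lower semicontinuity and touching from below by a paraboloid\<close>

lemma lsc_on_subset: "lsc_on S u \<Longrightarrow> T \<subseteq> S \<Longrightarrow> lsc_on T u"
  unfolding lsc_on_def by (auto intro: filter_leD[OF at_le])

lemma lsc_on_add_continuous:
  assumes "lsc_on S u" "continuous_on S g"
  shows "lsc_on S (\<lambda>x. u x + g x)"
  unfolding lsc_on_def
proof (intro ballI allI impI)
  fix x a assume x: "x \<in> S" and a: "a < u x + g x"
  define e where "e = (u x + g x - a) / 2"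
  have "u x - e < u x" "g x - e < g x" using a by (auto simp: e_def)
  moreover have "(g \<longlongrightarrow> g x) (at x within S)"
    using assms x by (auto simp: continuous_on_def)
  ultimately have "\<forall>\<^sub>F y in at x within S. u x - e < u y" "\<forall>\<^sub>F y in at x within S. g x - e < g y"
    using assms x by (auto simp: lsc_on_def order_tendsto_iff)
  then show "\<forall>\<^sub>F y in at x within S. a < u y + g y"
    by eventually_elim (simp add: e_def field_simps)
qed

text \<open>Without a minimum every \<open>x\<close> has a point \<open>p x\<close> of smaller
  value, and \<open>h\<close> stays above \<open>h (p x)\<close> near \<open>x\<close>. In a finite
  subcover take the \<open>x\<close> with least \<open>h (p x)\<close>: the point \<open>p x\<close>
  lies in some \<open>T y\<close>, so \<open>h (p y) < h (p x)\<close>, a contradiction.\<close>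

lemma lsc_on_attains_min:
  assumes "compact S" "S \<noteq> {}" "lsc_on S h"
  shows "\<exists>x\<in>S. \<forall>y\<in>S. h x \<le> h y"
proof (rule ccontr)
  assume "\<not> ?thesis"
  then have "\<forall>x\<in>S. \<exists>y\<in>S. h y < h x" by (auto simp: not_le)
  then obtain p where p: "\<And>x. x \<in> S \<Longrightarrow> p x \<in> S" "\<And>x. x \<in> S \<Longrightarrow> h (p x) < h x" by metis
  have "\<exists>T. open T \<and> x \<in> T \<and> (\<forall>z\<in>T \<inter> S. h (p x) < h z)" if "x \<in> S" for x
  proof -
    have "\<forall>\<^sub>F z in at x within S. h (p x) < h z"
      using assms(3) p(2)[OF that] that by (simp add: lsc_on_def)
    then obtain T where "open T" "x \<in> T" "\<And>z. z \<in> T \<Longrightarrow> z \<noteq> x \<Longrightarrow> z \<in> S \<Longrightarrow> h (p x) < h z"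
      unfolding eventually_at_topological by auto
    with p(2)[OF that] show ?thesis by (intro exI[of _ T]) (metis IntE)
  qed
  then obtain T where T: "\<And>x. x \<in> S \<Longrightarrow> open (T x)" "\<And>x. x \<in> S \<Longrightarrow> x \<in> T x"
    "\<And>x z. x \<in> S \<Longrightarrow> z \<in> T x \<Longrightarrow> z \<in> S \<Longrightarrow> h (p x) < h z" by (metis IntI)
  obtain D where D: "D \<subseteq> S" "finite D" "S \<subseteq> (\<Union>x\<in>D. T x)"
    by (rule compactE_image[OF assms(1), of S T]) (use T in auto)
  with assms(2) have "D \<noteq> {}" by auto
  with D obtain x where x: "x \<in> D" "\<And>y. y \<in> D \<Longrightarrow> h (p x) \<le> h (p y)"
    using arg_min_if_finite[of D "\<lambda>x. h (p x)"] by (metis not_le)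
  then have "p x \<in> S" using D p by auto
  then obtain y where "y \<in> D" "p x \<in> T y" using D by auto
  with T(3)[of y "p x"] x(2)[of y] D \<open>p x \<in> S\<close> show False by auto
qed

lemma C2_function_paraboloid: "C2_function (\<lambda>z::'a::euclidean_space. m - c * (norm z)\<^sup>2)"
proof -
  \<comment> \<open>The gradient \<open>(- 2 * c) *\<^sub>R z\<close> is linear in \<open>z\<close>,
    so its derivative is the same map at every point.\<close>
  let ?L = "\<lambda>z::'a. blinfun_inner_right ((- 2 * c) *\<^sub>R z)"
  have L: "bounded_linear ?L"
    by (rule bounded_linear_compose[OF bounded_linear_blinfun_inner_right bounded_linear_scaleR_right])
  have "((\<lambda>z::'a. m - c * (norm z)\<^sup>2) has_derivative blinfun_apply (?L x)) (at x)" for x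
    unfolding power2_norm_eq_inner
    by (auto intro!: derivative_eq_intros ext simp: inner_commute)
  moreover have "(?L has_derivative blinfun_apply (Blinfun ?L)) (at x)" for x
    unfolding bounded_linear_Blinfun_apply[OF L] by (rule bounded_linear_imp_has_derivative[OF L])
  ultimately show ?thesis
    unfolding C2_function_def
    by (intro exI[of _ ?L] exI[of _ "\<lambda>_. Blinfun ?L"] conjI allI continuous_on_const)
qed

text \<open>Minimise \<open>u z + k * (norm z / r)\<^sup>2\<close> over the closed ball. The minimum
  is at most \<open>u 0 < k\<close>, while \<open>u \<ge> 0\<close> makes the function at least
  \<open>k\<close> wherever \<open>norm z \<ge> r\<close>. Hence the minimiser is interior and the
  inequality extends to all of space.\<close>

lemma touching_paraboloid:
  fixes u :: "'a::euclidean_space \<Rightarrow> real"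
  assumes lsc: "lsc_on (cball 0 r) u" and nonneg: "\<And>x. 0 \<le> u x" and r: "0 < r" and k: "u 0 < k"
  obtains x\<^sub>0 where "norm x\<^sub>0 < r" "u x\<^sub>0 \<le> u 0"
    "\<And>z. u x\<^sub>0 + k * (norm x\<^sub>0 / r)\<^sup>2 - k * (norm z / r)\<^sup>2 \<le> u z"
proof -
  let ?h = "\<lambda>z. u z + k * (norm z / r)\<^sup>2"
  have "lsc_on (cball 0 r) ?h"
    using r by (intro lsc_on_add_continuous lsc continuous_intros) auto
  then obtain x where x: "x \<in> cball 0 r" "\<And>z. z \<in> cball 0 r \<Longrightarrow> ?h x \<le> ?h z"
    using lsc_on_attains_min[of "cball 0 r" ?h] r by auto
  have k0: "0 < k" using nonneg[of 0] k by linarith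
  have h0: "?h x \<le> u 0" using x(2)[of 0] r by simp
  have hk: "u z + k * (norm z / r)\<^sup>2 \<ge> k" if "r \<le> norm z" for z
  proof -
    have "1 \<le> (norm z / r)\<^sup>2" using that r by simp
    then show ?thesis using k0 nonneg[of z] by (simp add: add_increasing)
  qed
  show thesis
  proof (rule that)
    show "norm x < r" using hk[of x] h0 k by linarith
    show "u x \<le> u 0" using h0 k0 by (smt (verit) mult_nonneg_nonneg zero_le_power2)
    show "?h x - k * (norm z / r)\<^sup>2 \<le> u z" for z
      using x(2)[of z] hk[of z] h0 k by (cases "norm z \<le> r") auto
  qed
qed

section \<open>The equation at the touching point and the resulting bound on the integral\<close>

lemma set_integrable_ball:
  fixes u :: "'a::euclidean_space \<Rightarrow> real"
  assumes u: "u \<in> borel_measurable lebesgue" and "\<And>x. \<bar>u x\<bar> \<le> U"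
  shows "set_integrable lebesgue (ball z r) u"
  unfolding set_integrable_def
proof (rule Bochner_Integration.integrable_bound)
  have "emeasure lebesgue (ball z r) < \<infinity>"
    using emeasure_bounded_finite[OF bounded_ball, of z r] by simp
  then show "integrable lebesgue (\<lambda>x::'a. U * indicator (ball z r) x)"
    by (intro integrable_mult_right integrable_real_indicator) auto
  show "AE x in lebesgue. norm (indicator (ball z r) x *\<^sub>R u x) \<le> norm (U * indicator (ball z r) x)"
  proof (rule AE_I2)
    show "norm (indicator (ball z r) x *\<^sub>R u x) \<le> norm (U * indicator (ball z r) x)" for x
      using assms(2)[of x] by (auto simp: indicator_def)
  qed
  show "(\<lambda>x. indicator (ball z r) x *\<^sub>R u x) \<in> borel_measurable lebesgue"
    by (intro borel_measurable_scaleR borel_measurable_indicator u) simp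
qed

lemma measure_lebesgue_ball:
  "0 \<le> r \<Longrightarrow> measure lebesgue (ball (z::'a::euclidean_space) r) = unit_ball_vol DIM('a) * r ^ DIM('a)"
  by (simp add: content_ball)

text \<open>In \<open>ball x\<^sub>0 \<rho>\<close> the test function is the paraboloid, with second
  difference at most \<open>0\<close>; this ball adds nothing to the positive part and costs the
  term with \<open>U\<close>. Outside it, \<open>u (x\<^sub>0 - y) \<ge> 0\<close> and
  \<open>u x\<^sub>0 \<le> k\<close> leave a second difference of at least
  \<open>u (x\<^sub>0 + y) - 2 * k\<close>.\<close>

lemma touching_point_integral_le:
  fixes u :: "'a::euclidean_space \<Rightarrow> real"
  assumes adm: "admissible_weight \<beta> \<kappa> \<phi>" and lam: "0 < lam" "0 < \<Lambda>" and \<alpha>: "0 < \<alpha>" "\<alpha> < 2"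
    and r: "0 < \<rho>" "\<rho> < r"
    and int: "integrable lebesgue (kernel_majorant \<alpha> \<phi> r :: 'a \<Rightarrow> real)"
    and nonneg: "\<And>x. 0 \<le> u x" and U: "\<And>x. u x \<le> U" and k: "u x\<^sub>0 \<le> k"
    and sol: "viscosity_supersolution (extremal_min lam \<Lambda> \<alpha> \<phi>) (\<lambda>x. C\<^sub>0) (ball 0 (2 * r)) u"
    and x\<^sub>0: "norm x\<^sub>0 < r"
    and touch: "\<And>z. u x\<^sub>0 + k * (norm x\<^sub>0 / r)\<^sup>2 - k * (norm z / r)\<^sup>2 \<le> u z"
  shows "lam * (2 - \<alpha>) / ((2 * r) ^ DIM('a) * (2 * r) powr \<alpha>) *
      ((LINT x:ball 0 r|lebesgue. u x) - 2 * k * measure lebesgue (ball (0::'a) r)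
        - U * measure lebesgue (ball x\<^sub>0 \<rho>))
    \<le> C\<^sub>0 + 2 * \<Lambda> * k * (LINT y|lebesgue. kernel_majorant \<alpha> \<phi> r (y::'a))"
    (is "?c * _ \<le> _")
proof -
  let ?d = "DIM('a)" and ?G = "kernel_majorant \<alpha> \<phi> r :: 'a \<Rightarrow> real"
  define \<psi> where "\<psi> z = u x\<^sub>0 + k * (norm x\<^sub>0 / r)\<^sup>2 - k * (norm z / r)\<^sup>2" for z :: 'a
  define N where "N = ball x\<^sub>0 \<rho>"
  define v where "v z = (if z \<in> N then \<psi> z else u z)" for z
  define P where "P y = lam * second_diff_pos v x\<^sub>0 y / norm y ^ ?d * ((2 - \<alpha>) / norm y powr \<alpha>)" for y
  define Q where "Q y = \<Lambda> * second_diff_neg v x\<^sub>0 y / norm y ^ ?d *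
          ((2 - \<alpha>) / norm y powr \<alpha> + \<phi> (1 / norm y))" for y
  have r0: "0 < r" using r by simp
  have k0: "0 \<le> k" using nonneg[of x\<^sub>0] k by linarith
  have U0: "0 \<le> U" using nonneg[of x\<^sub>0] U[of x\<^sub>0] by linarith
  have phi: "0 < \<phi> (1 / norm y)" if "y \<noteq> 0" for y :: 'a
    using adm that by (auto simp: admissible_weight_def)
  have mu[measurable]: "u \<in> borel_measurable lebesgue"
    using sol by (simp add: viscosity_supersolution_def)
  have "(\<integral>y. P y - Q y \<partial>lebesgue) \<le> C\<^sub>0"
  proof -
    have \<psi>: "\<psi> = (\<lambda>z. (u x\<^sub>0 + k * (norm x\<^sub>0 / r)\<^sup>2) - (k / r\<^sup>2) * (norm z)\<^sup>2)"
      by (auto simp: \<psi>_def power_divide)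
    have "C2_function \<psi>" unfolding \<psi> by (rule C2_function_paraboloid)
    moreover have "open N" "x\<^sub>0 \<in> N" "compact (closure N)" using r by (auto simp: N_def)
    moreover have "closure N \<subseteq> ball 0 (2 * r)"
    proof -
      have "norm z < 2 * r" if "dist x\<^sub>0 z \<le> \<rho>" for z
        using that x\<^sub>0 r norm_triangle_ineq[of x\<^sub>0 "z - x\<^sub>0"] by (auto simp: dist_norm norm_minus_commute)
      then show ?thesis using r by (auto simp: N_def)
    qed
    moreover have "\<forall>z\<in>N. \<psi> z \<le> u z" "\<psi> x\<^sub>0 = u x\<^sub>0" using touch by (auto simp: \<psi>_def)
    moreover have "x\<^sub>0 \<in> ball 0 (2 * r)" using x\<^sub>0 r by auto
    ultimately have "extremal_min lam \<Lambda> \<alpha> \<phi> v x\<^sub>0 \<le> C\<^sub>0"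
      using sol unfolding viscosity_supersolution_def v_def by blast
    then show ?thesis by (simp add: extremal_min_def P_def Q_def)
  qed
  have near: "second_diff v x\<^sub>0 y = - 2 * k * (norm y / r)\<^sup>2" if "norm y < \<rho>" for y
  proof -
    have "second_diff v x\<^sub>0 y = \<psi> (x\<^sub>0 + y) + \<psi> (x\<^sub>0 - y) - 2 * \<psi> x\<^sub>0"
      using that r by (simp add: second_diff_def v_def N_def dist_norm)
    also have "\<dots> = - (k / r\<^sup>2) * ((norm (x\<^sub>0 + y))\<^sup>2 + (norm (x\<^sub>0 - y))\<^sup>2 - 2 * (norm x\<^sub>0)\<^sup>2)"
      by (simp add: \<psi>_def power_divide algebra_simps)
    also have "(norm (x\<^sub>0 + y))\<^sup>2 + (norm (x\<^sub>0 - y))\<^sup>2 - 2 * (norm x\<^sub>0)\<^sup>2 = 2 * (norm y)\<^sup>2"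
      by (simp add: power2_norm_eq_inner inner_add inner_diff inner_commute)
    finally show ?thesis by (simp add: power_divide)
  qed
  have far: "second_diff v x\<^sub>0 y = u (x\<^sub>0 + y) + u (x\<^sub>0 - y) - 2 * u x\<^sub>0" if "\<rho> \<le> norm y" for y
    using that r by (simp add: second_diff_def v_def N_def dist_norm \<psi>_def)
  \<comment> \<open>For long increments the touching inequality at \<open>x\<^sub>0 + y\<close> and
    \<open>x\<^sub>0 - y\<close> with the parallelogram law gives the quadratic bound, and
    \<open>u \<ge> 0\<close> gives \<open>2 * k\<close>. For short ones the second difference is
    explicit and \<open>\<rho> < r\<close> makes the square the minimum.\<close>
  have neg_le: "second_diff_neg v x\<^sub>0 y \<le> 2 * k * min ((norm y / r)\<^sup>2) 1" for y
  proof (cases "norm y < \<rho>")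
    case True
    then have "norm y / r \<le> 1" using r by simp
    then have "(norm y / r)\<^sup>2 \<le> 1" using r by (intro power_le_one) auto
    then show ?thesis using near[OF True] k0 by (simp add: second_diff_neg_def)
  next
    case False
    have "(norm (x\<^sub>0 + y))\<^sup>2 + (norm (x\<^sub>0 - y))\<^sup>2 = 2 * (norm x\<^sub>0)\<^sup>2 + 2 * (norm y)\<^sup>2"
      by (simp add: power2_norm_eq_inner inner_add inner_diff inner_commute)
    then have "(norm (x\<^sub>0 + y) / r)\<^sup>2 + (norm (x\<^sub>0 - y) / r)\<^sup>2 = 2 * (norm x\<^sub>0 / r)\<^sup>2 + 2 * (norm y / r)\<^sup>2"
      by (simp add: power_divide flip: add_divide_distrib)
    then have "k * (norm (x\<^sub>0 + y) / r)\<^sup>2 + k * (norm (x\<^sub>0 - y) / r)\<^sup>2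
        = 2 * (k * (norm x\<^sub>0 / r)\<^sup>2) + 2 * (k * (norm y / r)\<^sup>2)"
      by (simp only: mult.left_commute[of 2] flip: distrib_left)
    then have "- second_diff v x\<^sub>0 y \<le> 2 * (k * (norm y / r)\<^sup>2)"
      using far[of y] touch[of "x\<^sub>0 + y"] touch[of "x\<^sub>0 - y"] False by linarith
    then have "- second_diff v x\<^sub>0 y \<le> 2 * k * (norm y / r)\<^sup>2"
      by (simp only: mult.assoc)
    moreover have "- second_diff v x\<^sub>0 y \<le> 2 * k"
      using far[of y] nonneg[of "x\<^sub>0 + y"] nonneg[of "x\<^sub>0 - y"] k False by simp
    ultimately show ?thesis
      using k0 by (auto simp: second_diff_neg_def min_def)
  qed
  have pos_near: "second_diff_pos v x\<^sub>0 y = 0" if "norm y < \<rho>" for y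
    using near[OF that] k0 by (simp add: second_diff_pos_def)
  \<comment> \<open>This crude bound, with constants depending on \<open>U\<close> and
    \<open>\<rho>\<close>, serves only to make \<open>P\<close> integrable; it does not enter the
    estimate.\<close>
  have pos_le: "second_diff_pos v x\<^sub>0 y \<le> 2 * U * (r / \<rho>)\<^sup>2 * min ((norm y / r)\<^sup>2) 1" for y
  proof (cases "norm y < \<rho>")
    case True
    then show ?thesis using pos_near U0 by simp
  next
    case False
    have "(\<rho> / r)\<^sup>2 \<le> min ((norm y / r)\<^sup>2) 1"
      using False r by (auto intro!: power_mono divide_right_mono power_le_one)
    then have "2 * U * (r / \<rho>)\<^sup>2 * (\<rho> / r)\<^sup>2 \<le> 2 * U * (r / \<rho>)\<^sup>2 * min ((norm y / r)\<^sup>2) 1"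
      using U0 by (intro mult_left_mono) auto
    moreover have "2 * U * (r / \<rho>)\<^sup>2 * (\<rho> / r)\<^sup>2 = 2 * U"
      using r by (simp add: field_simps)
    moreover have "second_diff_pos v x\<^sub>0 y \<le> 2 * U"
      using far[of y] False U[of "x\<^sub>0 + y"] U[of "x\<^sub>0 - y"] nonneg[of x\<^sub>0] U0 by (simp add: second_diff_pos_def)
    ultimately show ?thesis by linarith
  qed
  have kern0: "0 \<le> (2 - \<alpha>) / norm y powr \<alpha>" "0 \<le> (2 - \<alpha>) / norm y powr \<alpha> + \<phi> (1 / norm y)"
    if "y \<noteq> 0" for y :: 'a
    using \<alpha> phi[OF that] by (auto intro!: add_nonneg_nonneg)
  have P0: "0 \<le> P y" for y
    unfolding P_def second_diff_pos_def using lam \<alpha> by auto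
  \<comment> \<open>At \<open>y = 0\<close> the sign of \<open>\<phi> (1 / norm y)\<close>, which is
    \<open>\<phi> 0\<close>, is unknown, but division by \<open>norm y ^ ?d = 0\<close> makes
    \<open>Q y\<close> zero.\<close>
  have Q0: "0 \<le> Q y" for y
    using kern0(2)[of y] lam by (cases "y = 0") (auto simp: Q_def second_diff_neg_def zero_power)
  have Q_le: "Q y \<le> 2 * \<Lambda> * k * ?G y" for y
  proof (cases "y = 0")
    case False
    have "Q y \<le> \<Lambda> * (2 * k * min ((norm y / r)\<^sup>2) 1) / norm y ^ ?d *
          ((2 - \<alpha>) / norm y powr \<alpha> + \<phi> (1 / norm y))"
      unfolding Q_def using lam neg_le kern0[OF False]
      by (intro mult_right_mono divide_right_mono mult_left_mono) auto
    then show ?thesis by (simp add: kernel_majorant_def mult_ac)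
  qed (simp add: Q_def kernel_majorant_def zero_power)
  have P_le: "P y \<le> lam * (2 * U * (r / \<rho>)\<^sup>2) * ?G y" for y
  proof (cases "y = 0")
    case False
    have "P y \<le> lam * (2 * U * (r / \<rho>)\<^sup>2 * min ((norm y / r)\<^sup>2) 1) / norm y ^ ?d *
          ((2 - \<alpha>) / norm y powr \<alpha> + \<phi> (1 / norm y))"
      unfolding P_def using lam pos_le phi[OF False] kern0[OF False] U0
      by (intro mult_mono divide_right_mono mult_left_mono) (auto simp: less_imp_le)
    then show ?thesis by (simp add: kernel_majorant_def mult_ac)
  qed (simp add: P_def kernel_majorant_def zero_power)
  have mv: "v \<in> borel_measurable lebesgue"
  proof -
    have [measurable]: "\<psi> \<in> borel_measurable lebesgue" unfolding \<psi>_def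
      by (rule measurable_completion) measurable
    have [measurable]: "N \<in> sets lebesgue" by (simp add: N_def)
    show ?thesis unfolding v_def by measurable
  qed
  have mdiff: "(\<lambda>y. second_diff v x\<^sub>0 y) \<in> borel_measurable lebesgue"
    unfolding second_diff_def
    using measurable_compose[OF lebesgue_translation_distr(1) mv, of x\<^sub>0]
      measurable_compose[OF lebesgue_translation_distr(3) mv, of x\<^sub>0]
    by measurable
  have mk: "(\<lambda>y::'a. norm y ^ ?d) \<in> borel_measurable lebesgue" "(\<lambda>y::'a. (2 - \<alpha>) / norm y powr \<alpha>) \<in> borel_measurable lebesgue"
    by (rule measurable_completion; measurable)+
  have mphi: "(\<lambda>y::'a. \<phi> (1 / norm y)) \<in> borel_measurable lebesgue"
    using adm by (intro measurable_inverse_norm) (simp add: admissible_weight_def)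
  have "P \<in> borel_measurable lebesgue" "Q \<in> borel_measurable lebesgue"
    unfolding P_def Q_def second_diff_pos_def second_diff_neg_def
    using mdiff mk mphi by measurable
  have iP: "integrable lebesgue P"
  proof (rule Bochner_Integration.integrable_bound)
    show "integrable lebesgue (\<lambda>y. lam * (2 * U * (r / \<rho>)\<^sup>2) * ?G y)" using int by (rule integrable_mult_right)
    show "AE y in lebesgue. norm (P y) \<le> norm (lam * (2 * U * (r / \<rho>)\<^sup>2) * ?G y)"
    proof (rule AE_I2)
      show "norm (P y) \<le> norm (lam * (2 * U * (r / \<rho>)\<^sup>2) * ?G y)" for y using P0[of y] P_le[of y] by simp
    qed
  qed fact
  have iQ: "integrable lebesgue Q"
  proof (rule Bochner_Integration.integrable_bound)
    show "integrable lebesgue (\<lambda>y. 2 * \<Lambda> * k * ?G y)" using int by (rule integrable_mult_right)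
    show "AE y in lebesgue. norm (Q y) \<le> norm (2 * \<Lambda> * k * ?G y)"
    proof (rule AE_I2)
      show "norm (Q y) \<le> norm (2 * \<Lambda> * k * ?G y)" for y using Q0[of y] Q_le[of y] by simp
    qed
  qed fact
  have "(\<integral>y. Q y \<partial>lebesgue) \<le> (\<integral>y. 2 * \<Lambda> * k * ?G y \<partial>lebesgue)"
    using int iQ Q_le by (intro integral_mono) auto
  with \<open>(\<integral>y. P y - Q y \<partial>lebesgue) \<le> C\<^sub>0\<close> iP iQ
  have IP: "(\<integral>y. P y \<partial>lebesgue) \<le> C\<^sub>0 + 2 * \<Lambda> * k * (\<integral>y. ?G y \<partial>lebesgue)"
    by simp
  \<comment> \<open>\<open>f\<close> is chosen so that \<open>?c * f (x\<^sub>0 + y)\<close> lies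
    below \<open>P y\<close>: it is \<open>u z - 2 * k\<close> on the part of the ball outside
    \<open>N\<close>, and at most \<open>0\<close> elsewhere, on \<open>N\<close> because
    \<open>U\<close> is subtracted there.\<close>
  define f where "f z = indicator (ball 0 r) z * u z - (2 * k) * indicator (ball 0 r) z - U * indicator N z" for z
  have c0: "0 \<le> ?c" using lam \<alpha> r0 by (intro divide_nonneg_nonneg mult_nonneg_nonneg) auto
  have f_le: "?c * f (x\<^sub>0 + y) \<le> P y" for y
  proof (cases "x\<^sub>0 + y \<in> ball 0 r \<and> \<rho> \<le> norm y")
    case False
    have "f (x\<^sub>0 + y) \<le> 0"
      using False U[of "x\<^sub>0 + y"] U0 k0 by (auto simp: f_def N_def dist_norm indicator_def)
    then have "?c * f (x\<^sub>0 + y) \<le> 0" using c0 by (rule mult_nonneg_nonpos[rotated])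
    then show ?thesis using P0[of y] by linarith
  next
    case True
    \<comment> \<open>Both \<open>x\<^sub>0\<close> and \<open>x\<^sub>0 + y\<close> lie in the ball
      of radius \<open>r\<close>, so the kernel, with its factor \<open>lam\<close>, is at least its
      value \<open>?c\<close> at distance \<open>2 * r\<close>.\<close>
    have y: "norm y \<le> 2 * r" "0 < norm y"
      using True x\<^sub>0 r norm_triangle_ineq4[of "x\<^sub>0 + y" "x\<^sub>0"] by auto
    have "f (x\<^sub>0 + y) = u (x\<^sub>0 + y) - 2 * k"
      using True by (auto simp: f_def N_def dist_norm)
    also have "\<dots> \<le> second_diff_pos v x\<^sub>0 y"
      using far[of y] True k nonneg[of "x\<^sub>0 - y"] by (simp add: second_diff_pos_def)
    finally have "?c * f (x\<^sub>0 + y) \<le> ?c * second_diff_pos v x\<^sub>0 y"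
      using c0 by (rule mult_left_mono)
    also have "\<dots> \<le> lam * (2 - \<alpha>) / (norm y ^ ?d * norm y powr \<alpha>) * second_diff_pos v x\<^sub>0 y"
      using y \<alpha> lam r0 by (intro mult_right_mono divide_left_mono mult_mono power_mono powr_mono2)
        (auto simp: second_diff_pos_def)
    also have "\<dots> = P y" by (simp add: P_def mult_ac)
    finally show ?thesis .
  qed
  have fin: "emeasure lebesgue (ball z s) < \<infinity>" for z :: 'a and s
    using emeasure_bounded_finite[OF bounded_ball, of z s] by simp
  have iu: "integrable lebesgue (\<lambda>z. indicator (ball 0 r) z * u z)"
    using set_integrable_ball[OF mu, of U 0 r] U nonneg by (simp add: set_integrable_def)
  have if': "integrable lebesgue f"
    unfolding f_def N_def using fin
    by (intro Bochner_Integration.integrable_diff iu integrable_mult_right integrable_real_indicator) auto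
  have If: "(\<integral>z. f z \<partial>lebesgue) = (LINT x:ball 0 r|lebesgue. u x) - 2 * k * measure lebesgue (ball (0::'a) r)
        - U * measure lebesgue N"
    unfolding f_def N_def using fin iu by (simp add: set_lebesgue_integral_def)
  have tr: "integrable lebesgue (\<lambda>y. f (x\<^sub>0 + y))" "(\<integral>y. f (x\<^sub>0 + y) \<partial>lebesgue) = (\<integral>z. f z \<partial>lebesgue)"
    using if' integrable_distr_eq[OF lebesgue_translation_distr(1), of f x\<^sub>0]
      integral_distr[OF lebesgue_translation_distr(1), of f x\<^sub>0]
    by (simp_all add: lebesgue_translation_distr(2) borel_measurable_integrable)
  have "?c * (\<integral>z. f z \<partial>lebesgue) = (\<integral>y. ?c * f (x\<^sub>0 + y) \<partial>lebesgue)"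
    by (simp add: tr(2))
  also have "\<dots> \<le> (\<integral>y. P y \<partial>lebesgue)"
    by (rule integral_mono[OF integrable_mult_right[OF tr(1)] iP]) (rule f_le)
  also note IP
  finally show ?thesis by (simp add: If N_def)
qed

text \<open>\<open>touching_point_integral_le\<close> is applied for every \<open>k > u 0\<close>
  and every \<open>\<rho> < r\<close>. First \<open>\<rho>\<close> tends to \<open>0\<close>, which
  frees the constant from the bound \<open>U\<close>, then \<open>k\<close> decreases to
  \<open>u 0\<close>.\<close>

lemma supersolution_integral_le:
  assumes lam: "0 < lam" "lam \<le> \<Lambda>" and par: "0 < \<beta>" "\<beta> < \<alpha>" "\<alpha> < 2" "0 < \<kappa>"
    and adm: "admissible_weight \<beta> \<kappa> \<phi>"
  shows "\<exists>M>0. \<forall>r C\<^sub>0. \<forall>u :: 'a::euclidean_space \<Rightarrow> real.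
    0 < r \<and> r \<le> 1 \<and> 0 \<le> C\<^sub>0 \<and> (\<forall>x. 0 \<le> u x) \<and>
    viscosity_supersolution (extremal_min lam \<Lambda> \<alpha> \<phi>) (\<lambda>x. C\<^sub>0) (ball 0 (2 * r)) u
    \<longrightarrow> (LINT x:ball 0 r|lebesgue. u x) \<le> M * r ^ DIM('a) * (u 0 + C\<^sub>0 * r powr \<alpha>)"
proof -
  let ?d = "DIM('a)"
  obtain M1 where M1: "0 < M1" "\<And>r. 0 < r \<Longrightarrow> r \<le> 1 \<Longrightarrow> integrable lebesgue (kernel_majorant \<alpha> \<phi> r :: 'a \<Rightarrow> real)"
    "\<And>r. 0 < r \<Longrightarrow> r \<le> 1 \<Longrightarrow> (LINT y|lebesgue. kernel_majorant \<alpha> \<phi> r (y::'a)) \<le> M1 * r powr - \<alpha>"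
    using integral_kernel_majorant_le[OF adm par(4,1,2,3), where 'a='a] by blast
  define \<omega> where "\<omega> = unit_ball_vol ?d"
  have \<omega>: "0 \<le> \<omega>" by (simp add: \<omega>_def)
  \<comment> \<open>The inverse of the coefficient on the left of
    \<open>touching_point_integral_le\<close>, with the powers of \<open>r\<close> taken
    out.\<close>
  define D where "D = 2 ^ ?d * 2 powr \<alpha> / (lam * (2 - \<alpha>))"
  have D: "0 < D" unfolding D_def using lam par by simp
  \<comment> \<open>\<open>2 * \<omega>\<close> pays for subtracting \<open>2 * k\<close> on the
    ball; the other term bounds the right-hand side, where \<open>r powr - \<alpha>\<close> from the
    kernel cancels against \<open>r powr \<alpha>\<close>.\<close>
  define M where "M = 2 * \<omega> + D * (1 + 2 * \<Lambda> * M1)"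
  have M: "0 < M"
    unfolding M_def using \<omega> D M1(1) lam by (intro add_nonneg_pos mult_pos_pos) auto
  have "(LINT x:ball 0 r|lebesgue. u x) \<le> M * r ^ ?d * (u 0 + C\<^sub>0 * r powr \<alpha>)"
    if r: "0 < r" "r \<le> 1" and C: "0 \<le> C\<^sub>0" and nonneg: "\<And>x. 0 \<le> u x"
      and sol: "viscosity_supersolution (extremal_min lam \<Lambda> \<alpha> \<phi>) (\<lambda>x. C\<^sub>0) (ball 0 (2 * r)) u"
    for r C\<^sub>0 and u :: "'a \<Rightarrow> real"
  proof -
    let ?I = "LINT x:ball 0 r|lebesgue. u x"
    have "bounded (range u)" and lsc: "lsc_on (closure (ball 0 (2 * r))) u"
      using sol by (simp_all add: viscosity_supersolution_def)
    then obtain U where "\<And>x. norm (u x) \<le> U" by (auto simp: bounded_iff)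
    then have U: "u x \<le> U" for x by (simp add: abs_le_iff)
    have main: "?I \<le> M * r ^ ?d * (k + C\<^sub>0 * r powr \<alpha>)" if k: "u 0 < k" for k
    proof -
      have k0: "0 < k" using nonneg[of 0] k by linarith
      have lsc': "lsc_on (cball 0 r) u"
        using r by (intro lsc_on_subset[OF lsc]) auto
      obtain x\<^sub>0 where x\<^sub>0: "norm x\<^sub>0 < r" "u x\<^sub>0 \<le> u 0"
        "\<And>z. u x\<^sub>0 + k * (norm x\<^sub>0 / r)\<^sup>2 - k * (norm z / r)\<^sup>2 \<le> u z"
        by (rule touching_paraboloid[where u = u and r = r and k = k, OF lsc' nonneg r(1) k]) blast
      have c: "lam * (2 - \<alpha>) / ((2 * r) ^ ?d * (2 * r) powr \<alpha>) = 1 / (D * r ^ ?d * r powr \<alpha>)"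
        using r by (simp add: D_def power_mult_distrib powr_mult)
      have le: "?I \<le> M * r ^ ?d * (k + C\<^sub>0 * r powr \<alpha>) + U * (\<omega> * \<rho> ^ ?d)" if \<rho>: "0 < \<rho>" "\<rho> < r" for \<rho>
      proof -
        have "0 < \<Lambda>" "0 < \<alpha>" "u x\<^sub>0 \<le> k" using lam par x\<^sub>0(2) k by linarith+
        moreover have "measure lebesgue (ball (0::'a) r) = \<omega> * r ^ ?d" "measure lebesgue (ball x\<^sub>0 \<rho>) = \<omega> * \<rho> ^ ?d"
          unfolding \<omega>_def by (rule measure_lebesgue_ball, use r \<rho> in simp)+
        ultimately have "1 / (D * r ^ ?d * r powr \<alpha>) * (?I - 2 * k * (\<omega> * r ^ ?d) - U * (\<omega> * \<rho> ^ ?d))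
            \<le> C\<^sub>0 + 2 * \<Lambda> * k * (LINT y|lebesgue. kernel_majorant \<alpha> \<phi> r (y::'a))"
          using touching_point_integral_le[OF adm lam(1) _ _ par(3) \<rho> M1(2)[OF r] nonneg U _ sol x\<^sub>0(1,3)]
          by (simp only: c)
        also have "\<dots> \<le> C\<^sub>0 + 2 * \<Lambda> * k * (M1 * r powr - \<alpha>)"
          using M1(3)[OF r] lam k0 by (intro add_left_mono mult_left_mono) auto
        finally have "?I - 2 * k * (\<omega> * r ^ ?d) - U * (\<omega> * \<rho> ^ ?d)
            \<le> (C\<^sub>0 + 2 * \<Lambda> * k * (M1 * r powr - \<alpha>)) * (D * r ^ ?d * r powr \<alpha>)"
          using D r by (simp add: divide_le_eq)
        also have "\<dots> = r ^ ?d * D * (C\<^sub>0 * r powr \<alpha> + 2 * \<Lambda> * M1 * k)"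
          using r by (simp add: powr_minus field_simps)
        also have "\<dots> \<le> r ^ ?d * D * ((1 + 2 * \<Lambda> * M1) * (k + C\<^sub>0 * r powr \<alpha>))"
        proof -
          have "0 \<le> 2 * \<Lambda> * M1 * (C\<^sub>0 * r powr \<alpha>)" using lam M1(1) C by simp
          then show ?thesis
            using r D k0 by (intro mult_left_mono) (auto simp: algebra_simps)
        qed
        finally have "?I \<le> r ^ ?d * (2 * \<omega> * k + D * (1 + 2 * \<Lambda> * M1) * (k + C\<^sub>0 * r powr \<alpha>)) + U * (\<omega> * \<rho> ^ ?d)"
          by (simp add: algebra_simps)
        also have "2 * \<omega> * k \<le> 2 * \<omega> * (k + C\<^sub>0 * r powr \<alpha>)"
          using \<omega> C by (intro mult_left_mono) auto
        finally show ?thesis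
          using r by (simp add: M_def algebra_simps)
      qed
      \<comment> \<open>The point \<open>x\<^sub>0\<close> does not depend on \<open>\<rho>\<close>,
        so \<open>\<rho>\<close> may tend to \<open>0\<close>; the limit term \<open>0 ^ ?d\<close>
        vanishes because the dimension is positive.\<close>
      have "((\<lambda>\<rho>. M * r ^ ?d * (k + C\<^sub>0 * r powr \<alpha>) + U * (\<omega> * \<rho> ^ ?d)) \<longlongrightarrow>
          M * r ^ ?d * (k + C\<^sub>0 * r powr \<alpha>) + U * (\<omega> * 0 ^ ?d)) (at_right 0)"
        by (intro tendsto_intros)
      moreover have "\<forall>\<^sub>F \<rho> in at_right 0. ?I \<le> M * r ^ ?d * (k + C\<^sub>0 * r powr \<alpha>) + U * (\<omega> * \<rho> ^ ?d)"
        using r(1) by (auto simp: eventually_at_right_field intro!: exI[of _ r] le)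
      ultimately have "?I \<le> M * r ^ ?d * (k + C\<^sub>0 * r powr \<alpha>) + U * (\<omega> * 0 ^ ?d)"
        by (rule tendsto_lowerbound) simp
      then show ?thesis by (simp add: zero_power)
    qed
    have "((\<lambda>k. M * r ^ ?d * (k + C\<^sub>0 * r powr \<alpha>)) \<longlongrightarrow> M * r ^ ?d * (u 0 + C\<^sub>0 * r powr \<alpha>)) (at_right (u 0))"
      by (intro tendsto_intros)
    moreover have "\<forall>\<^sub>F k in at_right (u 0). ?I \<le> M * r ^ ?d * (k + C\<^sub>0 * r powr \<alpha>)"
      using eventually_at_right_less[of "u 0"] by eventually_elim (rule main)
    ultimately show ?thesis
      by (rule tendsto_lowerbound) simp
  qed
  with M show ?thesis by blast
qed

section \<open>From the integral bound to the level sets and the quasi-norm\<close>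

text \<open>Cauchy--Schwarz in the form \<open>2 sqrt u \<le> s + u / s\<close> with \<open>s\<^sup>2\<close> slightly larger than \<open>A\<close>, which avoids
  division by \<open>A = 0\<close>.\<close>

lemma Lq_norm_half_le:
  fixes u :: "'a::euclidean_space \<Rightarrow> real"
  assumes u: "u \<in> borel_measurable lebesgue" "\<And>x. 0 \<le> u x" "\<And>x. u x \<le> U"
    and B: "measure lebesgue (ball (0::'a) r) \<le> b" "(LINT x:ball 0 r|lebesgue. u x) \<le> M * A" and A: "0 \<le> A" and "0 \<le> M"
  shows "Lq_norm (1 / 2) (ball 0 r) u \<le> ((b + M) / 2)\<^sup>2 * A"
proof -
  let ?J = "LINT x:ball 0 r|lebesgue. \<bar>u x\<bar> powr (1 / 2)"
  have b0: "0 \<le> b" using B(1) measure_nonneg[of lebesgue "ball (0::'a) r"] by linarith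
  have J0: "0 \<le> ?J"
    unfolding set_lebesgue_integral_def by (intro Bochner_Integration.integral_nonneg) auto
  have main: "?J\<^sup>2 \<le> ((b + M) / 2)\<^sup>2 * a" if "A < a" for a
  proof -
    have a0: "0 < a" using that A by linarith
    define s where "s = sqrt a"
    have s: "0 < s" "s * s = a" using a0 by (auto simp: s_def)
    have iu: "set_integrable lebesgue (ball 0 r) u"
      using u by (intro set_integrable_ball[of _ U]) auto
    have i1: "set_integrable lebesgue (ball (0::'a) r) (\<lambda>x. s / 2)"
      using s by (intro set_integrable_ball[of _ s]) auto
    have "?J \<le> (LINT x:ball 0 r|lebesgue. s / 2 + 1 / (2 * s) * u x)"
    proof (rule set_integral_mono)
      show "set_integrable lebesgue (ball 0 r) (\<lambda>x. \<bar>u x\<bar> powr (1 / 2))"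
      proof (rule set_integrable_ball[of _ "U powr (1 / 2)"])
        show "\<bar>\<bar>u x\<bar> powr (1 / 2)\<bar> \<le> U powr (1 / 2)" for x
          using u(2,3)[of x] by (simp add: powr_mono2)
      qed (use u(1) in measurable)
      show "set_integrable lebesgue (ball 0 r) (\<lambda>x. s / 2 + 1 / (2 * s) * u x)"
        by (intro set_integral_add i1 set_integrable_mult_right iu)
      show "\<bar>u x\<bar> powr (1 / 2) \<le> s / 2 + 1 / (2 * s) * u x" for x
      proof -
        have "0 \<le> (s - sqrt (u x))\<^sup>2" by simp
        then have "2 * s * sqrt (u x) \<le> s * s + u x"
          using u(2)[of x] by (simp add: power2_eq_square algebra_simps)
        then show ?thesis
          using s u(2)[of x] by (simp add: powr_half_sqrt field_simps)
      qed
    qed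
    also have "\<dots> = s / 2 * measure lebesgue (ball (0::'a) r) + 1 / (2 * s) * (LINT x:ball 0 r|lebesgue. u x)"
      using set_integral_add(2)[OF i1 set_integrable_mult_right[OF iu], of "1 / (2 * s)"]
      by (simp add: set_lebesgue_integral_def mult_ac)
    also have "\<dots> \<le> s / 2 * b + 1 / (2 * s) * (M * a)"
      using s B that \<open>0 \<le> M\<close> order_trans[OF B(2) mult_left_mono[of A a M]]
      by (intro add_mono mult_left_mono) auto
    \<comment> \<open>Since \<open>a = s * s\<close>, both terms are multiples of
      \<open>s\<close>.\<close>
    also have "\<dots> = s * ((b + M) / 2)"
      using s(1) unfolding s(2)[symmetric] by (simp add: field_simps)
    finally have "?J\<^sup>2 \<le> (s * ((b + M) / 2))\<^sup>2"
      using J0 by (rule power_mono)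
    also have "\<dots> = ((b + M) / 2)\<^sup>2 * (s * s)"
      by (simp only: power2_eq_square mult_ac)
    finally show ?thesis by (simp only: s(2))
  qed
  have "((\<lambda>a. ((b + M) / 2)\<^sup>2 * a) \<longlongrightarrow> ((b + M) / 2)\<^sup>2 * A) (at_right A)"
    by (intro tendsto_intros)
  moreover have "\<forall>\<^sub>F a in at_right A. ?J\<^sup>2 \<le> ((b + M) / 2)\<^sup>2 * a"
    using eventually_at_right_less[of A] by eventually_elim (rule main)
  ultimately have "?J\<^sup>2 \<le> ((b + M) / 2)\<^sup>2 * A"
    by (rule tendsto_lowerbound) simp
  moreover have "Lq_norm (1 / 2) (ball 0 r) u = ?J\<^sup>2"
    using J0 by (simp add: Lq_norm_def)
  ultimately show ?thesis by simp
qed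

theorem theorem3p4:
  fixes lam \<Lambda> \<alpha> \<beta> \<kappa> :: real and \<phi> :: "real \<Rightarrow> real"
  assumes "0 < lam" and "lam \<le> \<Lambda>"
    and "0 < \<beta>" and "\<beta> < 2" and "\<beta> < \<alpha>" and "\<alpha> < 2"
    and "0 < \<kappa>" and "admissible_weight \<beta> \<kappa> \<phi>"
  shows "\<exists>C>0. \<exists>\<epsilon>>0. \<forall>r C\<^sub>0. \<forall>u :: 'a::euclidean_space \<Rightarrow> real.
    0 < r \<and> r \<le> 1 \<and> 0 \<le> C\<^sub>0 \<and> (\<forall>x. 0 \<le> u x) \<and>
    viscosity_supersolution (extremal_min lam \<Lambda> \<alpha> \<phi>) (\<lambda>x. C\<^sub>0) (ball 0 (2 * r)) u
    \<longrightarrow>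
      (\<forall>t>0. measure lebesgue ({x. t \<le> u x} \<inter> ball 0 r)
               \<le> C * r ^ DIM('a) * (u 0 + C\<^sub>0 * r powr \<alpha>) powr \<epsilon> * t powr (- \<epsilon>)) \<and>
      Lq_norm (\<epsilon> / 2) (ball 0 r) u \<le> C * (u 0 + C\<^sub>0 * r powr \<alpha>)"
proof -
  let ?d = "DIM('a)"
  obtain M where M: "0 < M" and le: "\<And>r C\<^sub>0 u. 0 < r \<Longrightarrow> r \<le> 1 \<Longrightarrow> 0 \<le> C\<^sub>0 \<Longrightarrow> \<forall>x. 0 \<le> u x \<Longrightarrow>
      viscosity_supersolution (extremal_min lam \<Lambda> \<alpha> \<phi>) (\<lambda>x. C\<^sub>0) (ball 0 (2 * r)) u \<Longrightarrow>
      (LINT x:ball 0 r|lebesgue. u x) \<le> M * r ^ ?d * (u (0::'a) + C\<^sub>0 * r powr \<alpha>)"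
    using supersolution_integral_le[OF assms(1,2,3,5,6,7,8), where 'a='a] by blast
  define \<omega> where "\<omega> = unit_ball_vol ?d"
  have \<omega>: "0 \<le> \<omega>" by (simp add: \<omega>_def)
  \<comment> \<open>One constant for both claims: the first summand serves the level sets, the
    second the quasi-norm.\<close>
  define C where "C = M + ((\<omega> + M) / 2)\<^sup>2"
  have C: "0 < C" unfolding C_def using M by (intro add_pos_nonneg) auto
  have main: "(\<forall>t>0. measure lebesgue ({x. t \<le> u x} \<inter> ball 0 r)
               \<le> C * r ^ ?d * (u 0 + C\<^sub>0 * r powr \<alpha>) powr 1 * t powr (- 1)) \<and>
      Lq_norm (1 / 2) (ball 0 r) u \<le> C * (u 0 + C\<^sub>0 * r powr \<alpha>)"
    if r: "0 < r" "r \<le> 1" and C0: "0 \<le> C\<^sub>0" and nonneg: "\<forall>x. 0 \<le> u x"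
      and sol: "viscosity_supersolution (extremal_min lam \<Lambda> \<alpha> \<phi>) (\<lambda>x. C\<^sub>0) (ball 0 (2 * r)) u"
    for r C\<^sub>0 and u :: "'a \<Rightarrow> real"
  proof (intro conjI allI impI)
    define A where "A = u 0 + C\<^sub>0 * r powr \<alpha>"
    have A: "0 \<le> A" using nonneg C0 by (simp add: A_def)
    have I: "(LINT x:ball 0 r|lebesgue. u x) \<le> M * r ^ ?d * A"
      unfolding A_def by (rule le[OF r C0 nonneg sol])
    have mu: "u \<in> borel_measurable lebesgue" and "bounded (range u)"
      using sol by (simp_all add: viscosity_supersolution_def)
    then obtain U where "\<And>x. norm (u x) \<le> U" by (auto simp: bounded_iff)
    then have U: "\<And>x. \<bar>u x\<bar> \<le> U" "\<And>x. u x \<le> U" by (simp_all add: abs_le_iff)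
    have rd: "0 \<le> r ^ ?d" "r ^ ?d \<le> 1" using r by (auto intro: power_le_one)
    {
      fix t :: real assume t: "0 < t"
      \<comment> \<open>Points outside the ball, where the cut-off function is \<open>0\<close>,
        drop out because \<open>t > 0\<close>.\<close>
      have "{x. t \<le> u x} \<inter> ball 0 r = {x\<in>space lebesgue. t \<le> indicator (ball 0 r) x *\<^sub>R u x}"
        using t by (auto simp: indicator_def)
      also have "measure lebesgue \<dots> \<le> (LINT x:ball 0 r|lebesgue. u x) / t"
        unfolding set_lebesgue_integral_def
        using set_integrable_ball[OF mu U(1), of 0 r] nonneg t
        by (intro integral_Markov_inequality_measure[of _ _ "{}"]) (auto simp: set_integrable_def)
      also have "\<dots> \<le> (M * r ^ ?d * A) / t"
        using I t by (intro divide_right_mono) auto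
      also have "\<dots> \<le> (C * r ^ ?d * A) / t"
        using A t rd by (intro divide_right_mono mult_right_mono) (auto simp: C_def)
      also have "\<dots> = C * r ^ ?d * A powr 1 * t powr (- 1)"
        using A t by (simp add: powr_minus divide_inverse)
      finally show "measure lebesgue ({x. t \<le> u x} \<inter> ball 0 r)
        \<le> C * r ^ ?d * (u 0 + C\<^sub>0 * r powr \<alpha>) powr 1 * t powr (- 1)"
        by (simp only: A_def)
    }
    \<comment> \<open>The quasi-norm bound carries no power of \<open>r\<close>;
      \<open>r \<le> 1\<close> allows \<open>r ^ ?d\<close> to be replaced by
      \<open>1\<close>.\<close>
    have "measure lebesgue (ball (0::'a) r) \<le> \<omega>"
      using r rd \<omega> by (subst measure_lebesgue_ball) (simp_all add: mult_left_le flip: \<omega>_def)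
    moreover have "(LINT x:ball 0 r|lebesgue. u x) \<le> M * A"
      using I mult_right_mono[OF mult_left_le[OF rd(2), of M] A] M by linarith
    ultimately have "Lq_norm (1 / 2) (ball 0 r) u \<le> ((\<omega> + M) / 2)\<^sup>2 * A"
      using nonneg M by (intro Lq_norm_half_le[OF mu _ U(2)] A) auto
    also have "\<dots> \<le> C * A"
      using A M by (intro mult_right_mono) (auto simp: C_def)
    finally show "Lq_norm (1 / 2) (ball 0 r) u \<le> C * (u 0 + C\<^sub>0 * r powr \<alpha>)"
      by (simp only: A_def)
  qed
  show ?thesis
    by (rule exI[of _ C], rule conjI[OF C], rule exI[of _ 1], rule conjI[OF zero_less_one],
        intro allI impI, elim conjE) (rule main; assumption)
qed

end
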